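(* Let $A$ be a commutative real C$^*$-algebra and let $V: A\times A \to \mathbb{R}$ be a continuous orthogonal (real bilinear) form. Then there exist $\varphi_1$ and $\varphi_2$ in $A^{*}$ satisfying $$V(x,y) = \varphi_1 (x y) + \varphi_2 ( x y^* )$$ for every $x,y\in A$.
   Context: A real C$^*$-algebra is a norm-closed real $^*$-subalgebra of a complex C$^*$-algebra; $A^*$ denotes the space of continuous real linear functionals $A\to\mathbb{R}$. Elements $a,b$ of a real C$^*$-algebra $A$ are orthogonal, written $a\perp b$, if $ab^*=b^*a=0$. A bilinear form $V$ on $A\times A$ is called orthogonal if $V(a,b)=0$ whenever $a\perp b$ in $A$. The algebra $A$ is not assumed to be unital. *)

theory Defs
  imports "HOL-Analysis.Analysis"
begin

text \<open>
  The library has no complex normed spaces, so the complex scalar multiplication is part of the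
  class. The class real_normed_algebra does not require a unit.
\<close>

class complex_cstar_algebra = real_normed_algebra + banach +
  fixes scaleC :: "complex \<Rightarrow> 'a \<Rightarrow> 'a" (infixr "*\<^sub>C" 75)
    and star :: "'a \<Rightarrow> 'a" ("(_\<^sup>\<star>)" [1000] 1000)
  assumes scaleC_add_right: "c *\<^sub>C (x + y) = c *\<^sub>C x + c *\<^sub>C y"
    and scaleC_add_left: "(c + d) *\<^sub>C x = c *\<^sub>C x + d *\<^sub>C x"
    and scaleC_scaleC: "c *\<^sub>C (d *\<^sub>C x) = (c * d) *\<^sub>C x"
    and scaleC_of_real: "complex_of_real r *\<^sub>C x = r *\<^sub>R x"
    and mult_scaleC_left: "(c *\<^sub>C x) * y = c *\<^sub>C (x * y)"
    and mult_scaleC_right: "x * (c *\<^sub>C y) = c *\<^sub>C (x * y)"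
    and norm_scaleC: "norm (c *\<^sub>C x) = cmod c * norm x"
    and star_add: "(x + y)\<^sup>\<star> = x\<^sup>\<star> + y\<^sup>\<star>"
    and star_scaleC: "(c *\<^sub>C x)\<^sup>\<star> = cnj c *\<^sub>C x\<^sup>\<star>"
    and star_mult: "(x * y)\<^sup>\<star> = y\<^sup>\<star> * x\<^sup>\<star>"
    and star_star: "(x\<^sup>\<star>)\<^sup>\<star> = x"
    and cstar_identity: "norm (x\<^sup>\<star> * x) = (norm x)\<^sup>2"

definition real_cstar_algebra :: "'a::complex_cstar_algebra set \<Rightarrow> bool" where
  "real_cstar_algebra A \<longleftrightarrow>
     subspace A \<and> (\<forall>x\<in>A. \<forall>y\<in>A. x * y \<in> A) \<and> (\<forall>x\<in>A. x\<^sup>\<star> \<in> A) \<and> closed A"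

definition commutative_real_cstar_algebra :: "'a::complex_cstar_algebra set \<Rightarrow> bool" where
  "commutative_real_cstar_algebra A \<longleftrightarrow>
     real_cstar_algebra A \<and> (\<forall>x\<in>A. \<forall>y\<in>A. x * y = y * x)"

definition cstar_orthogonal :: "'a::complex_cstar_algebra \<Rightarrow> 'a \<Rightarrow> bool" (infix "\<bottom>\<^sub>*" 50) where
  "a \<bottom>\<^sub>* b \<longleftrightarrow> a * b\<^sup>\<star> = 0 \<and> b\<^sup>\<star> * a = 0"

text \<open>
  Forms and functionals on \<open>A\<close> are total functions on the ambient type; their values outside
  \<open>A\<close> are unconstrained.
\<close>

definition real_linear_on :: "'a::real_vector set \<Rightarrow> ('a \<Rightarrow> real) \<Rightarrow> bool" where
  "real_linear_on A f \<longleftrightarrow>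
     (\<forall>x\<in>A. \<forall>y\<in>A. f (x + y) = f x + f y) \<and> (\<forall>r. \<forall>x\<in>A. f (r *\<^sub>R x) = r * f x)"

definition dual_space :: "'a::real_normed_vector set \<Rightarrow> ('a \<Rightarrow> real) set" where
  "dual_space A = {\<phi>. real_linear_on A \<phi> \<and> continuous_on A \<phi>}"

definition bilinear_form_on :: "'a::real_vector set \<Rightarrow> ('a \<Rightarrow> 'a \<Rightarrow> real) \<Rightarrow> bool" where
  "bilinear_form_on A V \<longleftrightarrow>
     (\<forall>y\<in>A. real_linear_on A (\<lambda>x. V x y)) \<and> (\<forall>x\<in>A. real_linear_on A (V x))"

definition orthogonal_form_on :: "'a::complex_cstar_algebra set \<Rightarrow> ('a \<Rightarrow> 'a \<Rightarrow> real) \<Rightarrow> bool" where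
  "orthogonal_form_on A V \<longleftrightarrow>
     bilinear_form_on A V \<and> (\<forall>a\<in>A. \<forall>b\<in>A. a \<bottom>\<^sub>* b \<longrightarrow> V a b = 0)"

end

theory Submission
  imports Defs
begin

text \<open>
  Characters represent \<open>A\<close> as an algebra of complex functions, on which a real function \<open>m\<close> that
  maps \<open>A\<close> into itself acts as a multiplier. A partition of unity along the values of \<open>m\<close>, whose
  non-adjacent members are orthogonal, shows that an orthogonal form satisfies \<open>V (m x) y = V x (m y)\<close>.

  Split \<open>x\<close> and \<open>y\<close> into self-adjoint and skew parts. If one argument is self-adjoint, an approximate
  unit \<open>u\<close> gives \<open>V h y \<approx> V (u h) y = V u (h y)\<close>, a bounded functional of \<open>h y\<close>. If both are skew, then
  \<open>V k (a\<^sup>2 k') = V a ((k k') a)\<close> for every skew \<open>a\<close>; averaging over truncated random sign sums \<open>a\<close> of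
  skew elements, whose mean square is bounded below, makes \<open>V k k'\<close> a bounded functional of \<open>k k'\<close> up
  to a small error. Compactness turns the approximate functionals into exact ones, and the three
  functionals so obtained combine to \<open>\<phi>\<^sub>1\<close> and \<open>\<phi>\<^sub>2\<close>.
\<close>

section \<open>Characters of commutative C*-algebras\<close>

text \<open>At a single character the elements take complex values, and a real bilinear form on the
  complex plane has four real coefficients, exactly those of Re (\<alpha> x y) + Re (\<beta> x cnj
  y). This is why two functionals can suffice, and the self-adjoint and skew parts isolate the four
  coefficients.

  The obstacle is that only real functions may be moved between the arguments:
  \<open>V (k * x) y\<close> and \<open>V x (k * y)\<close> differ in general for skew
  \<open>k\<close>. A self-adjoint element is itself a real function and can be moved directly. For
  two skew arguments an auxiliary skew element a is inserted, since k a is real-valued; what remains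
  is its square, which has to be inverted up to a small error.

  The algebra need not have a unit, so the character theory works with products against a fixed
  element in place of x - z 1. The approximate functionals obey bounds, C or 27 C, that do not
  depend on the finite set of elements they serve; this uniformity is what compactness
  needs.\<close>

lemma scaleC_zero_left [simp]: "(0::complex) *\<^sub>C x = 0" for x :: "'a::complex_cstar_algebra"
  using scaleC_of_real[of 0 x] by simp

lemma scaleC_zero_right [simp]: "c *\<^sub>C 0 = (0 :: 'a::complex_cstar_algebra)"
  using scaleC_add_right[of c "0::'a" 0] by simp

lemma scaleC_one [simp]: "1 *\<^sub>C x = x" for x :: "'a::complex_cstar_algebra"
  using scaleC_of_real[of 1 x] by simp

lemma scaleC_minus_left: "(- c) *\<^sub>C x = - (c *\<^sub>C x)" for x :: "'a::complex_cstar_algebra"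
  using scaleC_add_left[of "-c" c x] by (simp add: eq_neg_iff_add_eq_0)

lemma scaleC_minus_right: "c *\<^sub>C (- x) = - (c *\<^sub>C x)" for x :: "'a::complex_cstar_algebra"
  using scaleC_add_right[of c "-x" x] by (simp add: eq_neg_iff_add_eq_0)

lemma scaleC_diff_right: "c *\<^sub>C (x - y) = c *\<^sub>C x - c *\<^sub>C y" for x :: "'a::complex_cstar_algebra"
  using scaleC_add_right[of c x "-y"] by (simp add: scaleC_minus_right)

lemma star_zero [simp]: "0\<^sup>\<star> = (0 :: 'a::complex_cstar_algebra)"
  using star_add[of "0::'a" 0] by simp

lemma star_minus: "(- x)\<^sup>\<star> = - x\<^sup>\<star>" for x :: "'a::complex_cstar_algebra"
  using star_add[of "-x" x] by (simp add: eq_neg_iff_add_eq_0)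

lemma star_diff: "(x - y)\<^sup>\<star> = x\<^sup>\<star> - y\<^sup>\<star>" for x y :: "'a::complex_cstar_algebra"
  using star_add[of x "-y"] by (simp add: star_minus)

lemma star_scaleR: "(r *\<^sub>R x)\<^sup>\<star> = r *\<^sub>R x\<^sup>\<star>" for x :: "'a::complex_cstar_algebra"
  using star_scaleC[of "complex_of_real r" x] by (simp add: scaleC_of_real)

lemma norm_star [simp]: "norm (x\<^sup>\<star>) = norm x" for x :: "'a::complex_cstar_algebra"
proof -
  have le: "norm y \<le> norm (y\<^sup>\<star>)" for y :: 'a
  proof (cases "y = 0")
    case False
    have "(norm y)\<^sup>2 \<le> norm (y\<^sup>\<star>) * norm y"
      using norm_mult_ineq[of "y\<^sup>\<star>" y] by (simp add: cstar_identity)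
    then show ?thesis using False by (simp add: power2_eq_square)
  qed simp
  show ?thesis using le[of x] le[of "x\<^sup>\<star>"] by (simp add: star_star)
qed

section \<open>Seminorms on a commutative complex star-subalgebra\<close>

locale comm_star_subalgebra =
  fixes B :: "'a::complex_cstar_algebra set"
  assumes add_closed: "x \<in> B \<Longrightarrow> y \<in> B \<Longrightarrow> x + y \<in> B"
    and scaleC_closed: "x \<in> B \<Longrightarrow> c *\<^sub>C x \<in> B"
    and mult_closed: "x \<in> B \<Longrightarrow> y \<in> B \<Longrightarrow> x * y \<in> B"
    and star_closed: "x \<in> B \<Longrightarrow> x\<^sup>\<star> \<in> B"
    and commute: "x \<in> B \<Longrightarrow> y \<in> B \<Longrightarrow> x * y = y * x"
begin

lemma minus_closed: "x \<in> B \<Longrightarrow> - x \<in> B"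
  using scaleC_closed[of x "-1"] by (simp add: scaleC_minus_left)

lemma diff_closed: "x \<in> B \<Longrightarrow> y \<in> B \<Longrightarrow> x - y \<in> B"
  using add_closed[of x "-y"] minus_closed by simp

lemma left_commute: "x \<in> B \<Longrightarrow> y \<in> B \<Longrightarrow> x * (y * z) = y * (x * z)"
  by (metis commute mult.assoc)

text \<open>Since \<open>x\<close> commutes with its adjoint,
  \<open>(x * x)\<^sup>\<star> * (x * x) = w * w\<close> with \<open>w = x\<^sup>\<star> * x\<close>
  self-adjoint; the C*-identity is then used for \<open>x * x\<close>, for \<open>w\<close> and for
  \<open>x\<close>. This puts the norm itself among the seminorms below.\<close>

lemma norm_mult_self:
  assumes "x \<in> B"
  shows "norm (x * x) = (norm x)\<^sup>2"
proof -
  let ?w = "x\<^sup>\<star> * x"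
  have sw: "?w\<^sup>\<star> = ?w" by (simp add: star_mult star_star)
  have "(x * x)\<^sup>\<star> * (x * x) = ?w * ?w"
    using assms star_closed[OF assms] by (simp add: star_mult mult.assoc left_commute)
  then have "(norm (x * x))\<^sup>2 = norm (?w\<^sup>\<star> * ?w)"
    by (metis sw cstar_identity)
  also have "\<dots> = ((norm x)\<^sup>2)\<^sup>2" by (simp only: cstar_identity)
  finally show ?thesis by (rule power2_eq_imp_eq) simp_all
qed

text \<open>The law for squares is the part of the C*-identity that survives limits along powers;
  full multiplicativity will come from minimality. The value 0 outside \<open>B\<close> makes two
  such functions equal as soon as they agree on \<open>B\<close>, so minimality can be stated for
  total functions.\<close>

definition cstar_seminorm :: "('a \<Rightarrow> real) \<Rightarrow> bool" where
  "cstar_seminorm p \<longleftrightarrow> (\<forall>x. 0 \<le> p x) \<and> (\<forall>x. x \<notin> B \<longrightarrow> p x = 0) \<and>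
     (\<forall>x\<in>B. \<forall>y\<in>B. p (x + y) \<le> p x + p y) \<and> (\<forall>x\<in>B. \<forall>y\<in>B. p (x * y) \<le> p x * p y) \<and>
     (\<forall>c. \<forall>x\<in>B. p (c *\<^sub>C x) = cmod c * p x) \<and>
     (\<forall>x\<in>B. p (x * x) = (p x)\<^sup>2) \<and> (\<forall>x\<in>B. p x \<le> norm x)"

lemma cstar_seminorm_norm: "cstar_seminorm (\<lambda>x. if x \<in> B then norm x else 0)"
  unfolding cstar_seminorm_def
  by (auto simp: add_closed scaleC_closed mult_closed norm_mult_self norm_triangle_ineq
      norm_mult_ineq norm_scaleC)

text \<open>Iterating left multiplication by \<open>x\<close> on \<open>y\<close> stands for x^n y.
  Without a unit x^0 has no meaning on its own, and x^(n+1) is the n-fold iteration applied to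
  \<open>x\<close>.\<close>

lemma funpow_mult_closed: "x \<in> B \<Longrightarrow> y \<in> B \<Longrightarrow> ((*) x ^^ n) y \<in> B"
  by (induction n) (auto simp: mult_closed)

lemma funpow_mult_mult:
  assumes "x \<in> B" "y \<in> B" "z \<in> B"
  shows "((*) x ^^ m) y * ((*) x ^^ n) z = ((*) x ^^ (m + n)) (y * z)"
proof (induction m)
  case 0
  show ?case
  proof (induction n)
    case (Suc n)
    then show ?case using assms left_commute[of y x] by (simp add: funpow_mult_closed)
  qed simp
qed (simp add: mult.assoc)

lemma funpow_mult_add: "((*) x ^^ n) (y + z) = ((*) x ^^ n) y + ((*) x ^^ n) (z :: 'a)"
  by (induction n) (auto simp: distrib_left)

lemma funpow_mult_scaleC: "((*) x ^^ n) (c *\<^sub>C y) = c *\<^sub>C ((*) x ^^ n) (y :: 'a)"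
  by (induction n) (auto simp: mult_scaleC_right)

text \<open>
  Passing to the limit makes \<open>p\<close> multiplicative against \<open>x\<close> at the price of decreasing it.
\<close>

definition radial :: "('a \<Rightarrow> real) \<Rightarrow> 'a \<Rightarrow> 'a \<Rightarrow> real" where
  "radial p x y = (if y \<in> B then lim (\<lambda>n. p (((*) x ^^ n) y) / p x ^ n) else 0)"

context
  fixes p x
  assumes p: "cstar_seminorm p" and x: "x \<in> B" and px: "p x > 0"
begin

lemma radial_decseq:
  assumes "y \<in> B"
  shows "decseq (\<lambda>n. p (((*) x ^^ n) y) / p x ^ n)"
proof (rule decseq_SucI)
  fix n
  have "p (((*) x ^^ Suc n) y) \<le> p x * p (((*) x ^^ n) y)"
    using p x funpow_mult_closed[OF x assms] by (simp add: cstar_seminorm_def)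
  then show "p (((*) x ^^ Suc n) y) / p x ^ Suc n \<le> p (((*) x ^^ n) y) / p x ^ n"
    using px by (simp add: field_simps)
qed

lemma radial_tendsto:
  assumes "y \<in> B"
  shows "(\<lambda>n. p (((*) x ^^ n) y) / p x ^ n) \<longlonglongrightarrow> radial p x y"
proof -
  have "\<forall>n. 0 \<le> p (((*) x ^^ n) y) / p x ^ n" using p px by (simp add: cstar_seminorm_def)
  then show ?thesis
    using decseq_convergent[OF radial_decseq[OF assms]] assms
    by (metis (no_types, lifting) limI radial_def)
qed

lemma radial_le:
  assumes "y \<in> B"
  shows "radial p x y \<le> p y"
  using decseq_ge[OF radial_decseq[OF assms] radial_tendsto[OF assms], of 0] by simp

text \<open>Products force the even subsequence: x^(2n) y z is the product of x^n y and x^n z, and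
  the normalizations multiply accordingly.\<close>

lemma radial_tendsto_double:
  assumes "y \<in> B"
  shows "(\<lambda>n. p (((*) x ^^ (n + n)) y) / (p x ^ n * p x ^ n)) \<longlonglongrightarrow> radial p x y"
  using LIMSEQ_subseq_LIMSEQ[OF radial_tendsto[OF assms], of "\<lambda>n. n + n"]
  by (simp add: o_def power_add strict_mono_def)

lemma cstar_seminorm_radial: "cstar_seminorm (radial p x)"
proof -
  have pos: "0 \<le> p y" for y using p by (simp add: cstar_seminorm_def)
  have 1: "0 \<le> radial p x y" for y
  proof (cases "y \<in> B")
    case True
    show ?thesis
      by (rule LIMSEQ_le_const[OF radial_tendsto[OF True]]) (use pos px in auto)
  qed (simp add: radial_def)
  have 2: "radial p x (y + z) \<le> radial p x y + radial p x z" if "y \<in> B" "z \<in> B" for y z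
  proof (rule LIMSEQ_le[OF radial_tendsto tendsto_add[OF radial_tendsto radial_tendsto]])
    have "p (((*) x ^^ n) (y + z)) \<le> p (((*) x ^^ n) y) + p (((*) x ^^ n) z)" for n
      using p funpow_mult_closed[OF x] that by (simp add: funpow_mult_add cstar_seminorm_def)
    then have "p (((*) x ^^ n) (y + z)) / p x ^ n
        \<le> p (((*) x ^^ n) y) / p x ^ n + p (((*) x ^^ n) z) / p x ^ n" for n
      using px by (metis add_divide_distrib divide_right_mono less_imp_le zero_less_power)
    then show "\<exists>N. \<forall>n\<ge>N. p (((*) x ^^ n) (y + z)) / p x ^ n
        \<le> p (((*) x ^^ n) y) / p x ^ n + p (((*) x ^^ n) z) / p x ^ n"
      by blast
  qed (use that add_closed in auto)
  have 3: "radial p x (y * z) \<le> radial p x y * radial p x z" if "y \<in> B" "z \<in> B" for y z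
  proof (rule LIMSEQ_le[OF radial_tendsto_double tendsto_mult[OF radial_tendsto radial_tendsto]])
    have "p (((*) x ^^ (n + n)) (y * z)) \<le> p (((*) x ^^ n) y) * p (((*) x ^^ n) z)" for n
      using p funpow_mult_closed[OF x] that
      by (simp add: funpow_mult_mult[OF x that, symmetric] cstar_seminorm_def)
    then have "p (((*) x ^^ (n + n)) (y * z)) / (p x ^ n * p x ^ n)
        \<le> p (((*) x ^^ n) y) / p x ^ n * (p (((*) x ^^ n) z) / p x ^ n)" for n
      using px by (simp add: divide_right_mono)
    then show "\<exists>N. \<forall>n\<ge>N. p (((*) x ^^ (n + n)) (y * z)) / (p x ^ n * p x ^ n)
        \<le> p (((*) x ^^ n) y) / p x ^ n * (p (((*) x ^^ n) z) / p x ^ n)"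
      by blast
  qed (use that mult_closed in auto)
  have 4: "radial p x (c *\<^sub>C y) = cmod c * radial p x y" if "y \<in> B" for c y
  proof (rule LIMSEQ_unique[OF radial_tendsto])
    have "p (((*) x ^^ n) (c *\<^sub>C y)) / p x ^ n = cmod c * (p (((*) x ^^ n) y) / p x ^ n)" for n
      using p funpow_mult_closed[OF x that] by (simp add: funpow_mult_scaleC cstar_seminorm_def)
    then show "(\<lambda>n. p (((*) x ^^ n) (c *\<^sub>C y)) / p x ^ n) \<longlonglongrightarrow> cmod c * radial p x y"
      by (simp only: tendsto_mult_left[OF radial_tendsto[OF that]])
  qed (use that scaleC_closed in auto)
  have 5: "radial p x (y * y) = (radial p x y)\<^sup>2" if "y \<in> B" for y
  proof (rule LIMSEQ_unique[OF radial_tendsto_double])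
    have "p (((*) x ^^ (n + n)) (y * y)) / (p x ^ n * p x ^ n) = (p (((*) x ^^ n) y) / p x ^ n)\<^sup>2" for n
      using p funpow_mult_closed[OF x that]
      by (simp add: funpow_mult_mult[OF x that that, symmetric] cstar_seminorm_def
          power2_eq_square)
    then show "(\<lambda>n. p (((*) x ^^ (n + n)) (y * y)) / (p x ^ n * p x ^ n)) \<longlonglongrightarrow> (radial p x y)\<^sup>2"
      using tendsto_power[OF radial_tendsto[OF that], of 2] by simp
  qed (use that mult_closed in auto)
  have 6: "radial p x y \<le> norm y" if "y \<in> B" for y
    using radial_le[OF that] p that by (simp add: cstar_seminorm_def order_trans)
  show ?thesis
    unfolding cstar_seminorm_def using 1 2 3 4 5 6 by (simp add: radial_def)
qed

text \<open>Multiplying by \<open>x\<close> shifts the defining sequence by one index, and the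
  normalization then lacks one factor \<open>p x\<close>.\<close>

lemma radial_mult:
  assumes "y \<in> B"
  shows "radial p x (x * y) = p x * radial p x y"
proof (rule LIMSEQ_unique[OF radial_tendsto])
  have "p (((*) x ^^ n) (x * y)) / p x ^ n = p x * (p (((*) x ^^ Suc n) y) / p x ^ Suc n)" for n
    using px by (simp add: funpow_swap1)
  then show "(\<lambda>n. p (((*) x ^^ n) (x * y)) / p x ^ n) \<longlonglongrightarrow> p x * radial p x y"
    using tendsto_mult_left[OF LIMSEQ_Suc[OF radial_tendsto[OF assms]], of "p x"] by simp
qed (use assms x mult_closed in auto)

text \<open>The law for squares gives equality at arbitrarily large exponents. Submultiplicativity
  bounds a high power by a lower one times a power of \<open>p x\<close>, so a defect at one
  exponent would persist at all larger ones. The n-fold iteration on \<open>x\<close> is x^(n+1),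
  hence \<open>Suc (n + n)\<close> after squaring.\<close>

lemma seminorm_power: "p (((*) x ^^ n) x) = p x ^ Suc n"
proof (rule antisym)
  let ?P = "\<lambda>n. p (((*) x ^^ n) x)"
  have closed: "((*) x ^^ n) x \<in> B" for n using funpow_mult_closed[OF x x] .
  have step: "?P (m + n) \<le> p x ^ m * ?P n" for m n
  proof (induction m)
    case (Suc m)
    have "?P (Suc m + n) \<le> p x * ?P (m + n)"
      using p x closed by (simp add: cstar_seminorm_def)
    also have "\<dots> \<le> p x * (p x ^ m * ?P n)" using Suc px by simp
    finally show ?case by (simp add: mult.assoc)
  qed simp
  show "?P n \<le> p x ^ Suc n" using step[of n 0] by (simp add: mult.commute)
  have square: "?P (Suc (n + n)) = (?P n)\<^sup>2" for n
  proof -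
    have "((*) x ^^ Suc (n + n)) x = ((*) x ^^ n) x * ((*) x ^^ n) x"
      by (simp add: funpow_mult_mult[OF x x x] funpow_swap1)
    then show ?thesis using p closed by (simp add: cstar_seminorm_def del: funpow.simps)
  qed
  have dyadic: "\<exists>m\<ge>k. ?P m = p x ^ Suc m" for k
  proof (induction k)
    case 0
    show ?case by (intro exI[of _ 0]) simp
  next
    case (Suc k)
    then obtain m where "m \<ge> k" "?P m = p x ^ Suc m" by blast
    then have "?P (Suc (m + m)) = p x ^ Suc (Suc (m + m))"
      by (simp add: square power2_eq_square power_add del: funpow.simps)
    with \<open>m \<ge> k\<close> show ?case by (intro exI[of _ "Suc (m + m)"]) (simp del: funpow.simps)
  qed
  obtain m where m: "m \<ge> n" "?P m = p x ^ Suc m" using dyadic by blast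
  have "p x ^ (m - n) * p x ^ Suc n = p x ^ Suc m"
    using m(1) by (simp flip: power_add)
  also have "\<dots> \<le> p x ^ (m - n) * ?P n" using step[of "m - n" n] m by simp
  finally show "p x ^ Suc n \<le> ?P n"
    using px by (metis mult_le_cancel_left_pos zero_less_power)
qed

lemma radial_self: "radial p x x = p x"
  by (rule LIMSEQ_unique[OF radial_tendsto[OF x]]) (use px in \<open>simp add: seminorm_power\<close>)

end

text \<open>In a chain one member can come close to the infimum at two points at once: of two
  members, each good at one point, the smaller is good at both. Two points are enough, because in
  the inequalities the left-hand side only uses that the infimum is a lower bound.\<close>

lemma cstar_seminorm_chain_Inf:
  assumes "C \<noteq> {}" and C: "\<And>p. p \<in> C \<Longrightarrow> cstar_seminorm p"
    and chain: "\<And>p q. p \<in> C \<Longrightarrow> q \<in> C \<Longrightarrow> p \<le> q \<or> q \<le> p"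
  shows "cstar_seminorm (\<lambda>x. INF p\<in>C. p x)"
proof -
  let ?i = "\<lambda>x. INF p\<in>C. p x"
  have pos: "0 \<le> p x" if "p \<in> C" for p x using C[OF that] by (simp add: cstar_seminorm_def)
  have bdd: "bdd_below ((\<lambda>p. p x) ` C)" for x
    by (rule bdd_belowI2[of _ 0]) (use pos in auto)
  have le: "?i x \<le> p x" if "p \<in> C" for p x by (rule cINF_lower[OF bdd that])
  have ipos: "0 \<le> ?i x" for x using \<open>C \<noteq> {}\<close> pos by (intro cINF_greatest) auto
  have approx: "\<exists>p\<in>C. p x < ?i x + e \<and> p y < ?i y + e" if "e > 0" for x y e
  proof -
    obtain p q where "p \<in> C" "p x < ?i x + e" "q \<in> C" "q y < ?i y + e"
      using \<open>C \<noteq> {}\<close> bdd \<open>e > 0\<close> by (metis (no_types, lifting) cINF_less_iff less_add_same_cancel1)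
    then show ?thesis using chain[of p q] by (meson le_funD le_less_trans)
  qed
  have 1: "?i (x + y) \<le> ?i x + ?i y" if "x \<in> B" "y \<in> B" for x y
  proof (rule field_le_epsilon)
    fix e :: real assume "e > 0"
    then obtain p where p: "p \<in> C" "p x < ?i x + e/2" "p y < ?i y + e/2"
      using approx[of "e/2" x y] by auto
    have "?i (x + y) \<le> p (x + y)" using le p by blast
    also have "\<dots> \<le> p x + p y" using C[OF p(1)] that by (simp add: cstar_seminorm_def)
    finally show "?i (x + y) \<le> ?i x + ?i y + e" using p by linarith
  qed
  have lim: "\<exists>f. (\<forall>n. f n \<in> C) \<and> (\<lambda>n. f n x) \<longlonglongrightarrow> ?i x \<and> (\<lambda>n. f n y) \<longlonglongrightarrow> ?i y" for x y
  proof -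
    have "\<forall>n. \<exists>p\<in>C. p x < ?i x + 1 / real (Suc n) \<and> p y < ?i y + 1 / real (Suc n)"
      using approx by simp
    then obtain f where f: "\<And>n. f n \<in> C" "\<And>n. f n x < ?i x + 1 / real (Suc n)"
      "\<And>n. f n y < ?i y + 1 / real (Suc n)" by metis
    have inv: "(\<lambda>n. c + 1 / real (Suc n)) \<longlonglongrightarrow> c" for c
      using tendsto_add[OF tendsto_const[of c] LIMSEQ_inverse_real_of_nat]
      by (simp add: inverse_eq_divide)
    have "(\<lambda>n. f n x) \<longlonglongrightarrow> ?i x"
      by (rule real_tendsto_sandwich[OF _ _ tendsto_const inv])
        (use le[OF f(1)] f(2) in \<open>simp_all add: less_imp_le\<close>)
    moreover have "(\<lambda>n. f n y) \<longlonglongrightarrow> ?i y"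
      by (rule real_tendsto_sandwich[OF _ _ tendsto_const inv])
        (use le[OF f(1)] f(3) in \<open>simp_all add: less_imp_le\<close>)
    ultimately show ?thesis using f(1) by blast
  qed
  have 2: "?i (x * y) \<le> ?i x * ?i y" if "x \<in> B" "y \<in> B" for x y
  proof -
    obtain f where f: "\<And>n. f n \<in> C" "(\<lambda>n. f n x) \<longlonglongrightarrow> ?i x" "(\<lambda>n. f n y) \<longlonglongrightarrow> ?i y"
      using lim by blast
    have "?i (x * y) \<le> f n x * f n y" for n
    proof -
      have "f n (x * y) \<le> f n x * f n y" using C[OF f(1)] that by (simp add: cstar_seminorm_def)
      then show ?thesis using le[OF f(1), of "x * y" n] by linarith
    qed
    then show ?thesis
      by (intro LIMSEQ_le_const[OF tendsto_mult[OF f(2,3)]]) auto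
  qed
  have 3: "?i (x * x) = (?i x)\<^sup>2" if "x \<in> B" for x
  proof -
    obtain f where f: "\<And>n. f n \<in> C" "(\<lambda>n. f n x) \<longlonglongrightarrow> ?i x" "(\<lambda>n. f n (x * x)) \<longlonglongrightarrow> ?i (x * x)"
      using lim by blast
    have "(\<lambda>n. f n (x * x)) = (\<lambda>n. (f n x)\<^sup>2)"
      by (rule ext) (use C[OF f(1)] that in \<open>simp add: cstar_seminorm_def\<close>)
    then show ?thesis using LIMSEQ_unique[OF f(3)] tendsto_power[OF f(2), of 2] by simp
  qed
  have 4: "?i (c *\<^sub>C x) = cmod c * ?i x" if "x \<in> B" for c x
  proof -
    obtain f where f: "\<And>n. f n \<in> C" "(\<lambda>n. f n x) \<longlonglongrightarrow> ?i x"
        "(\<lambda>n. f n (c *\<^sub>C x)) \<longlonglongrightarrow> ?i (c *\<^sub>C x)"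
      using lim by blast
    have "(\<lambda>n. f n (c *\<^sub>C x)) = (\<lambda>n. cmod c * f n x)"
      by (rule ext) (use C[OF f(1)] that in \<open>simp add: cstar_seminorm_def\<close>)
    then show ?thesis using LIMSEQ_unique[OF f(3)] tendsto_mult_left[OF f(2), of "cmod c"] by simp
  qed
  have 5: "?i x = 0" if "x \<notin> B" for x
  proof -
    have "?i x = (INF p\<in>C. 0)" using C that by (intro INF_cong) (auto simp: cstar_seminorm_def)
    then show ?thesis using \<open>C \<noteq> {}\<close> by simp
  qed
  have 6: "?i x \<le> norm x" if "x \<in> B" for x
  proof -
    obtain p where "p \<in> C" using \<open>C \<noteq> {}\<close> by blast
    moreover have "p x \<le> norm x" using C[OF \<open>p \<in> C\<close>] that by (simp add: cstar_seminorm_def)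
    ultimately show ?thesis using le[of p x] by linarith
  qed
  show ?thesis unfolding cstar_seminorm_def using ipos 1 2 3 4 5 6 by simp
qed

text \<open>
  A minimal seminorm coincides with all its smoothings and is therefore multiplicative.
\<close>

lemma multiplicative_seminorm_exists:
  assumes a: "a \<in> B" "a \<noteq> 0"
  obtains p where "cstar_seminorm p" "p a = norm a" "\<And>x y. x \<in> B \<Longrightarrow> y \<in> B \<Longrightarrow> p (x * y) = p x * p y"
proof -
  let ?F = "{p. cstar_seminorm p \<and> p a = norm a}"
  \<comment> \<open>Zorn's lemma runs downwards here. Fixing the value at \<open>a\<close> keeps a
    minimal seminorm from collapsing to 0.\<close>
  have "\<exists>m\<in>?F. \<forall>p\<in>?F. m \<ge> p \<longrightarrow> p = m"
  proof (rule predicate_Zorn)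
    show "partial_order_on ?F (relation_of (\<lambda>p q. q \<le> p) ?F)"
      by (rule partial_order_on_relation_ofI) auto
    fix C assume C: "C \<in> Chains (relation_of (\<lambda>p q. q \<le> p) ?F)"
    show "\<exists>u\<in>?F. \<forall>p\<in>C. u \<le> p"
    proof (cases "C = {}")
      case True
      then show ?thesis
        using cstar_seminorm_norm a by (intro bexI[of _ "\<lambda>x. if x \<in> B then norm x else 0"]) auto
    next
      case False
      have CF: "C \<subseteq> ?F" using C by (rule Chains_relation_of)
      have "cstar_seminorm (\<lambda>x. INF p\<in>C. p x)"
        by (rule cstar_seminorm_chain_Inf[OF False])
          (use CF C in \<open>auto simp: Chains_def relation_of_def\<close>)
      moreover have "(INF p\<in>C. p a) = (INF p\<in>C. norm a)" using CF by (intro INF_cong) auto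
      then have "(INF p\<in>C. p a) = norm a" using False by simp
      moreover have "(\<lambda>x. INF p\<in>C. p x) \<le> p" if "p \<in> C" for p
        using that CF by (intro le_funI cINF_lower bdd_belowI2[of _ 0])
          (auto simp: cstar_seminorm_def)
      ultimately show ?thesis by blast
    qed
  qed
  then obtain p where p: "cstar_seminorm p" "p a = norm a"
    and min: "\<And>q. cstar_seminorm q \<Longrightarrow> q a = norm a \<Longrightarrow> q \<le> p \<Longrightarrow> q = p" by auto
  have rle: "radial p x \<le> p" if "x \<in> B" "p x > 0" for x
    using radial_le[OF p(1) that] p(1) by (auto simp: le_fun_def radial_def cstar_seminorm_def)
  have pa: "p a > 0" using p a by simp
  \<comment> \<open>Smoothing at \<open>a\<close> keeps the value at \<open>a\<close>, so it stays
    in the family, and minimality forbids any decrease.\<close>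
  have "radial p a = p"
    using min[OF cstar_seminorm_radial[OF p(1) a(1) pa] _ rle[OF a(1) pa]]
      radial_self[OF p(1) a(1) pa] p by simp
  then have pam: "p (a * y) = p a * p y" if "y \<in> B" for y
    using radial_mult[OF p(1) a(1) pa that] by simp
  have pos: "0 \<le> p x" for x using p(1) by (simp add: cstar_seminorm_def)
  have "p (x * y) = p x * p y" if xy: "x \<in> B" "y \<in> B" for x y
  proof (cases "p x = 0")
    case True
    moreover have "p (x * y) \<le> p x * p y" using p(1) xy by (simp add: cstar_seminorm_def)
    ultimately show ?thesis using pos[of "x * y"] by simp
  next
    case False
    then have px: "p x > 0" using pos[of x] by simp
    \<comment> \<open>Smoothing at another \<open>x\<close> is admissible only if it too keeps the
      value at \<open>a\<close>. The multiplicativity against \<open>a\<close> just obtained,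
      applied to powers of \<open>x\<close>, gives exactly that.\<close>
    have pan: "p (((*) x ^^ n) a) = p x ^ n * p a" for n
    proof -
      have "a * ((*) x ^^ n) x = ((*) x ^^ n) (a * x)"
        using funpow_mult_mult[OF xy(1) a(1) xy(1), of 0 n] by simp
      also have "\<dots> = x * ((*) x ^^ n) a"
        using commute[OF a(1) xy(1)] by (simp add: funpow_swap1)
      finally have *: "a * ((*) x ^^ n) x = x * ((*) x ^^ n) a" .
      have "p a * p x ^ Suc n = p (x * ((*) x ^^ n) a)"
        using pam[of "((*) x ^^ n) x"] seminorm_power[OF p(1) xy(1) px, of n]
          funpow_mult_closed[OF xy(1) xy(1)] * by simp
      also have "\<dots> \<le> p x * p (((*) x ^^ n) a)"
        using p(1) xy(1) funpow_mult_closed[OF xy(1) a(1)] by (simp add: cstar_seminorm_def)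
      finally have ge: "p x ^ n * p a \<le> p (((*) x ^^ n) a)"
        using px by (simp add: ac_simps)
      have "p (((*) x ^^ n) a) / p x ^ n \<le> p a"
        using decseqD[OF radial_decseq[OF p(1) xy(1) px a(1)], of 0 n] by simp
      then have "p (((*) x ^^ n) a) \<le> p x ^ n * p a"
        using px by (simp add: pos_divide_le_eq mult.commute)
      with ge show ?thesis by (rule antisym[rotated])
    qed
    have "radial p x a = p a"
      by (rule LIMSEQ_unique[OF radial_tendsto[OF p(1) xy(1) px a(1)]]) (use px in \<open>simp add: pan\<close>)
    then have "radial p x = p"
      using min[OF cstar_seminorm_radial[OF p(1) xy(1) px] _ rle[OF xy(1) px]] p by simp
    then show ?thesis using radial_mult[OF p(1) xy(1) px xy(2)] by simp
  qed
  with p that show thesis by blast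
qed

end

section \<open>Spectral values, and the characters they define\<close>

lemma complex_square_root: "\<exists>w::complex. w * w = z"
  by (metis power2_csqrt power2_eq_square)

text \<open>The element \<open>e\<close> of seminorm 1 stands in for the unit:
  \<open>p (x * e - z *\<^sub>C e) = 0\<close> says that \<open>x\<close> acts as the scalar
  \<open>z\<close> modulo the kernel of \<open>p\<close>. Existence of such a \<open>z\<close> is a
  form of the Gelfand-Mazur theorem.\<close>

locale multiplicative_seminorm = comm_star_subalgebra +
  fixes p :: "'a \<Rightarrow> real" and e :: 'a
  assumes seminorm: "cstar_seminorm p"
    and mult: "x \<in> B \<Longrightarrow> y \<in> B \<Longrightarrow> p (x * y) = p x * p y"
    and e: "e \<in> B" "p e = 1"
begin

lemma nonneg: "0 \<le> p x" using seminorm by (simp add: cstar_seminorm_def)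

lemma triangle: "x \<in> B \<Longrightarrow> y \<in> B \<Longrightarrow> p (x + y) \<le> p x + p y"
  using seminorm by (simp add: cstar_seminorm_def)

lemma scale: "x \<in> B \<Longrightarrow> p (c *\<^sub>C x) = cmod c * p x"
  using seminorm by (simp add: cstar_seminorm_def)

lemma le_norm: "x \<in> B \<Longrightarrow> p x \<le> norm x"
  using seminorm by (simp add: cstar_seminorm_def)

lemma p_uminus: "x \<in> B \<Longrightarrow> p (- x) = p x"
  using scale[of x "-1"] by (simp add: scaleC_minus_left)

lemma triangle_diff: "x \<in> B \<Longrightarrow> y \<in> B \<Longrightarrow> p (x - y) \<le> p x + p y"
  using triangle[of x "-y"] p_uminus[of y] by (simp add: minus_closed)

lemma triangle_diff': "x \<in> B \<Longrightarrow> y \<in> B \<Longrightarrow> p x - p y \<le> p (x - y)"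
  using triangle[of "x - y" y] by (simp add: diff_closed)

lemmas closed = add_closed diff_closed mult_closed scaleC_closed e(1)

lemma square_diff:
  assumes "y \<in> B" "d \<in> B"
  shows "p (y * y - (w * w) *\<^sub>C (d * d)) = p (y - w *\<^sub>C d) * p (y - (- w) *\<^sub>C d)"
proof -
  have "y * y - (w * w) *\<^sub>C (d * d) = (y - w *\<^sub>C d) * (y - (- w) *\<^sub>C d)"
    using commute[OF assms]
    by (simp add: algebra_simps scaleC_minus_left mult_scaleC_left mult_scaleC_right scaleC_scaleC
          scaleC_diff_right scaleC_add_right)
  then show ?thesis using assms by (simp add: mult closed)
qed

text \<open>
  Replacing the usual factorization of \<open>y\<^sup>n - z\<^sup>n\<close> over the roots of unity by repeated squaring keeps
  everything inside a nonunital algebra.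
\<close>

lemma dyadic_distance:
  assumes "y \<in> B" "m > 0" and m: "\<And>w. m \<le> p (y - w *\<^sub>C e)"
  obtains Y E where "Y \<in> B" "E \<in> B" "p Y = p y ^ 2 ^ k" "p E = 1"
    "\<And>w. m ^ 2 ^ k \<le> p (Y - w *\<^sub>C E)"
    "\<And>z. p (y - z *\<^sub>C e) * m ^ (2 ^ k - 1) \<le> p (Y - z ^ 2 ^ k *\<^sub>C E)"
proof (induction k arbitrary: thesis)
  case 0
  show ?case by (rule 0[of y e]) (use assms e in auto)
next
  case (Suc k)
  obtain Y E where YE: "Y \<in> B" "E \<in> B" "p Y = p y ^ 2 ^ k" "p E = 1"
    and lo: "\<And>w. m ^ 2 ^ k \<le> p (Y - w *\<^sub>C E)"
    and up: "\<And>z. p (y - z *\<^sub>C e) * m ^ (2 ^ k - 1) \<le> p (Y - z ^ 2 ^ k *\<^sub>C E)"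
    using Suc.IH by blast
  show ?case
  proof (rule Suc.prems[of "Y * Y" "E * E"])
    show "m ^ 2 ^ Suc k \<le> p (Y * Y - w *\<^sub>C (E * E))" for w
    proof -
      obtain v where "v * v = w" using complex_square_root by blast
      then have "p (Y * Y - w *\<^sub>C (E * E)) = p (Y - v *\<^sub>C E) * p (Y - (- v) *\<^sub>C E)"
        using square_diff[OF YE(1,2), of v] by simp
      moreover have "m ^ 2 ^ k * m ^ 2 ^ k \<le> p (Y - v *\<^sub>C E) * p (Y - (- v) *\<^sub>C E)"
        using lo \<open>m > 0\<close> nonneg by (intro mult_mono) auto
      ultimately show ?thesis by (simp add: mult_2 power_add)
    qed
    show "p (y - z *\<^sub>C e) * m ^ (2 ^ Suc k - 1) \<le> p (Y * Y - z ^ 2 ^ Suc k *\<^sub>C (E * E))" for z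
    proof -
      have "(2::nat) ^ Suc k - 1 = (2 ^ k - 1) + 2 ^ k" by simp
      then have "p (y - z *\<^sub>C e) * m ^ (2 ^ Suc k - 1)
          = (p (y - z *\<^sub>C e) * m ^ (2 ^ k - 1)) * m ^ 2 ^ k" by (simp only: power_add mult.assoc)
      also have "\<dots> \<le> p (Y - z ^ 2 ^ k *\<^sub>C E) * p (Y - (- (z ^ 2 ^ k)) *\<^sub>C E)"
        using up lo \<open>m > 0\<close> nonneg by (intro mult_mono) auto
      also have "\<dots> = p (Y * Y - z ^ 2 ^ Suc k *\<^sub>C (E * E))"
        using square_diff[OF YE(1,2), of "z ^ 2 ^ k"] by (simp add: mult_2 power_add)
      finally show ?thesis .
    qed
  qed (use YE in \<open>simp_all add: mult closed mult_2 power_add\<close>)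
qed

text \<open>With N = 2^k, the factors of y^N - z^N e^N other than \<open>y - z *\<^sub>C e\<close>
  contribute at least m^(N-1), while the whole is at most m^N + |z|^N. Dividing leaves the bound m
  (1 + (|z|/m)^N), which tends to m because |z| < m.\<close>

lemma distance_constant_near_minimum:
  assumes y: "y \<in> B" and "m > 0" and m: "\<And>w. m \<le> p (y - w *\<^sub>C e)"
    and "p y = m" and z: "cmod z < m"
  shows "p (y - z *\<^sub>C e) = m"
proof (rule antisym[OF _ m])
  let ?r = "cmod z / m"
  have bound: "p (y - z *\<^sub>C e) \<le> m * (1 + ?r ^ 2 ^ k)" for k
  proof -
    obtain Y E where YE: "Y \<in> B" "E \<in> B" "p Y = p y ^ 2 ^ k" "p E = 1"
      and up: "p (y - z *\<^sub>C e) * m ^ (2 ^ k - 1) \<le> p (Y - z ^ 2 ^ k *\<^sub>C E)"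
      using dyadic_distance[OF y \<open>m > 0\<close> m] by metis
    have mm: "m ^ 2 ^ k = m * m ^ (2 ^ k - 1)" by (rule power_eq_if[THEN trans]) simp
    have "p (y - z *\<^sub>C e) * m ^ (2 ^ k - 1) \<le> m ^ 2 ^ k + cmod z ^ 2 ^ k"
      using up triangle_diff[OF YE(1) scaleC_closed[OF YE(2)], of "z ^ 2 ^ k"] YE \<open>p y = m\<close>
      by (simp add: scale norm_power)
    also have "\<dots> = m ^ 2 ^ k * (1 + ?r ^ 2 ^ k)"
      using \<open>m > 0\<close> by (simp add: power_divide distrib_left)
    also have "\<dots> = m * (1 + ?r ^ 2 ^ k) * m ^ (2 ^ k - 1)"
      unfolding mm by (simp only: mult.assoc mult.left_commute mult.commute)
    finally show ?thesis using zero_less_power[OF \<open>m > 0\<close>] mult_le_cancel_right_pos by blast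
  qed
  have "(\<lambda>k. ?r ^ 2 ^ k) \<longlonglongrightarrow> 0"
    using LIMSEQ_subseq_LIMSEQ[OF LIMSEQ_power_zero[of ?r], of "\<lambda>k. 2 ^ k"] z \<open>m > 0\<close>
    by (simp add: o_def strict_mono_def)
  from tendsto_mult_left[OF tendsto_add[OF tendsto_const[of 1] this], of m]
  show "p (y - z *\<^sub>C e) \<le> m" using bound by (auto intro: LIMSEQ_le_const)
qed

text \<open>As a function of \<open>z\<close> the distance is Lipschitz and grows like |z|, so it
  attains a minimum m. If m were positive, the value m would spread from a minimizer to every point
  closer than m, hence in steps of m/2 along a whole ray, against the growth.\<close>

lemma spectrum_nonempty:
  assumes x: "x \<in> B"
  obtains z where "p (x - z *\<^sub>C e) = 0"
proof -
  let ?f = "\<lambda>z. p (x - z *\<^sub>C e)"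
  have lip: "\<bar>?f z - ?f w\<bar> \<le> cmod (z - w)" for z w
  proof -
    have *: "?f z - ?f w \<le> cmod (z - w)" for z w
    proof -
      have "(x - z *\<^sub>C e) - (x - w *\<^sub>C e) = (w - z) *\<^sub>C e"
        using scaleC_add_left[of "w - z" z e] by simp
      then show ?thesis
        using triangle_diff'[of "x - z *\<^sub>C e" "x - w *\<^sub>C e"] x e
        by (simp add: closed scale norm_minus_commute)
    qed
    show ?thesis using *[of z w] *[of w z] by (simp add: norm_minus_commute abs_le_iff)
  qed
  have cont: "continuous_on S ?f" for S
    unfolding continuous_on_iff
    using lip by (metis dist_norm dist_real_def le_less_trans)
  have large: "cmod z - p x \<le> ?f z" for z
    using triangle_diff'[of "z *\<^sub>C e" x] p_uminus[of "x - z *\<^sub>C e"] x e by (simp add: closed scale)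
  \<comment> \<open>Beyond this radius the function exceeds \<open>p x\<close>, its value at 0, so a
    minimum over the disc is a global one.\<close>
  define M where "M = 2 * p x + 1"
  have "0 \<le> M" using nonneg[of x] by (simp add: M_def)
  then obtain z0 where z0: "\<And>w. w \<in> cball 0 M \<Longrightarrow> ?f z0 \<le> ?f w"
    using continuous_attains_inf[OF compact_cball _ cont, of 0 M] by (metis cball_eq_empty not_less)
  define m where "m = ?f z0"
  have min: "m \<le> ?f w" for w
  proof (cases "cmod w \<le> M")
    case False
    have "m \<le> ?f 0" using z0[of 0] \<open>0 \<le> M\<close> by (simp add: m_def)
    then show ?thesis using large[of w] False nonneg[of x] by (simp add: M_def)
  qed (use z0 in \<open>simp add: m_def\<close>)
  have "m = 0"
  proof (rule ccontr)
    assume "m \<noteq> 0"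
    then have "m > 0" using nonneg[of "x - z0 *\<^sub>C e"] by (simp add: m_def)
    have shift: "x - (z + w) *\<^sub>C e = (x - z *\<^sub>C e) - w *\<^sub>C e" for z w
      by (simp add: scaleC_add_left)
    have step: "?f (z + w) = m" if "?f z = m" "cmod w < m" for z w
      unfolding shift
      by (rule distance_constant_near_minimum)
        (use that x \<open>m > 0\<close> min in \<open>auto simp: closed shift[symmetric]\<close>)
    have "?f (z0 + of_real (real k * (m / 2))) = m" for k
    proof (induction k)
      case (Suc k)
      have "z0 + of_real (real (Suc k) * (m / 2)) = (z0 + of_real (real k * (m / 2))) + of_real (m / 2)"
        by (simp add: algebra_simps add_divide_distrib)
      moreover have "cmod (of_real (m / 2)) < m" using \<open>m > 0\<close> unfolding norm_of_real by simp
      ultimately show ?case using step[OF Suc, of "of_real (m / 2)"] by (simp only:)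
    qed (simp add: m_def)
    then have "cmod (z0 + of_real (real k * (m / 2))) \<le> m + p x" for k
      using large by (metis diff_le_eq)
    moreover have "real k * (m / 2) - cmod z0 \<le> cmod (z0 + of_real (real k * (m / 2)))" for k
      using norm_triangle_ineq2[of "of_real (real k * (m / 2))" "- z0"] \<open>m > 0\<close>
      by (simp add: norm_mult norm_divide add.commute)
    ultimately have "real k * (m / 2) \<le> m + p x + cmod z0" for k
      by (smt (verit))
    then show False using reals_Archimedean3[of "m / 2"] \<open>m > 0\<close>
      by (meson half_gt_zero linorder_not_le)
  qed
  then show thesis using that by (simp add: m_def)
qed

end

definition star_character :: "'a::complex_cstar_algebra set \<Rightarrow> ('a \<Rightarrow> complex) \<Rightarrow> bool" where
  "star_character A \<xi> \<longleftrightarrow>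
     (\<forall>x\<in>A. \<forall>y\<in>A. \<xi> (x + y) = \<xi> x + \<xi> y) \<and> (\<forall>x\<in>A. \<forall>r. \<xi> (r *\<^sub>R x) = of_real r * \<xi> x) \<and>
     (\<forall>x\<in>A. \<forall>y\<in>A. \<xi> (x * y) = \<xi> x * \<xi> y) \<and> (\<forall>x\<in>A. \<xi> (x\<^sup>\<star>) = cnj (\<xi> x)) \<and>
     (\<forall>x\<in>A. cmod (\<xi> x) \<le> norm x)"

text \<open>Arens' trick: for self-adjoint \<open>h\<close> the norm of h + it grows only like sqrt
  (|h|^2 + t^2). The product with \<open>a\<close> replaces h + it, which has no meaning without a
  unit. It forces characters to be real on self-adjoint elements.\<close>

lemma norm_self_adjoint_shift:
  fixes h a :: "'a::complex_cstar_algebra"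
  assumes h: "h\<^sup>\<star> = h"
  shows "norm (h * a + (\<i> * complex_of_real t) *\<^sub>C a) \<le> sqrt ((norm h)\<^sup>2 + t\<^sup>2) * norm a"
proof (rule power2_le_imp_le)
  let ?c = "\<i> * complex_of_real t"
  let ?y = "h * a + ?c *\<^sub>C a"
  have "?y\<^sup>\<star> * ?y = (a\<^sup>\<star> * h + (- ?c) *\<^sub>C a\<^sup>\<star>) * (h * a + ?c *\<^sub>C a)"
    by (simp add: star_add star_mult star_scaleC h)
  also have "\<dots> = a\<^sup>\<star> * (h * (h * a)) + (- ?c * ?c) *\<^sub>C (a\<^sup>\<star> * a)"
    by (simp add: distrib_left distrib_right mult_scaleC_left mult_scaleC_right scaleC_scaleC
        scaleC_minus_left scaleC_diff_right scaleC_add_right left_diff_distrib right_diff_distrib mult.assoc)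
  also have "- ?c * ?c = complex_of_real (t\<^sup>2)" by (simp add: power2_eq_square complex_eq_iff)
  finally have "?y\<^sup>\<star> * ?y = a\<^sup>\<star> * (h * (h * a)) + t\<^sup>2 *\<^sub>R (a\<^sup>\<star> * a)"
    by (simp only: scaleC_of_real)
  then have "(norm ?y)\<^sup>2 \<le> norm (a\<^sup>\<star> * (h * (h * a))) + t\<^sup>2 * norm (a\<^sup>\<star> * a)"
    using norm_triangle_ineq[of "a\<^sup>\<star> * (h * (h * a))" "t\<^sup>2 *\<^sub>R (a\<^sup>\<star> * a)"]
    by (simp flip: cstar_identity)
  also have "norm (a\<^sup>\<star> * (h * (h * a))) \<le> norm a * (norm h * (norm h * norm a))"
    by (intro order_trans[OF norm_mult_ineq] mult_mono) simp_all
  finally show "(norm ?y)\<^sup>2 \<le> (sqrt ((norm h)\<^sup>2 + t\<^sup>2) * norm a)\<^sup>2"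
    by (simp add: cstar_identity power_mult_distrib power2_eq_square algebra_simps)
qed simp

text \<open>The character sends \<open>x\<close> to the scalar by which it acts modulo the kernel of
  a multiplicative seminorm that norms \<open>a\<close>. The scalar is unique because
  \<open>e\<close> has seminorm 1, and uniqueness turns each algebraic identity modulo the kernel
  into a law for \<xi>.\<close>

lemma (in comm_star_subalgebra) star_character_exists:
  assumes a: "a \<in> B" "a \<noteq> 0"
  shows "\<exists>\<xi>. star_character B \<xi> \<and> cmod (\<xi> a) = norm a"
proof -
  obtain p where p: "cstar_seminorm p" "p a = norm a"
    and pm: "\<And>x y. x \<in> B \<Longrightarrow> y \<in> B \<Longrightarrow> p (x * y) = p x * p y"
    using multiplicative_seminorm_exists[OF a] by blast
  define e where "e = (1 / complex_of_real (norm a)) *\<^sub>C a"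
  have e: "e \<in> B" "p e = 1"
    using a p by (auto simp: e_def scaleC_closed cstar_seminorm_def norm_divide)
  interpret multiplicative_seminorm B p e
    by unfold_locales (simp_all only: p(1) pm e)
  have "\<exists>z. p (x * e - z *\<^sub>C e) = 0" if "x \<in> B" for x
    using spectrum_nonempty[of "x * e"] that by (metis closed(3) e(1))
  then obtain \<xi> where \<xi>: "\<And>x. x \<in> B \<Longrightarrow> p (x * e - \<xi> x *\<^sub>C e) = 0" by metis
  have uniq: "\<xi> x = z" if "x \<in> B" "p (x * e - z *\<^sub>C e) = 0" for x z
  proof -
    have "(x * e - z *\<^sub>C e) - (x * e - \<xi> x *\<^sub>C e) = (\<xi> x - z) *\<^sub>C e"
      using scaleC_add_left[of "\<xi> x - z" z e] by simp
    then have "cmod (\<xi> x - z) \<le> 0"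
      using triangle_diff[of "x * e - z *\<^sub>C e" "x * e - \<xi> x *\<^sub>C e"] that \<xi> e
      by (simp add: closed scale)
    then show ?thesis by simp
  qed
  have zero: "p (u + v) = 0" if "u \<in> B" "v \<in> B" "p u = 0" "p v = 0" for u v
    using triangle[OF that(1,2)] that nonneg[of "u + v"] by simp
  have scaleC: "\<xi> (c *\<^sub>C x) = c * \<xi> x" if x: "x \<in> B" for c x
  proof (rule uniq)
    have "c *\<^sub>C x * e - (c * \<xi> x) *\<^sub>C e = c *\<^sub>C (x * e - \<xi> x *\<^sub>C e)"
      using scaleC_add_right[of c "x * e - \<xi> x *\<^sub>C e" "\<xi> x *\<^sub>C e"]
      by (simp add: scaleC_scaleC mult_scaleC_left)
    then show "p (c *\<^sub>C x * e - (c * \<xi> x) *\<^sub>C e) = 0" using \<xi> x e by (simp add: scale closed)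
  qed (use x closed in auto)
  have add: "\<xi> (x + y) = \<xi> x + \<xi> y" if x: "x \<in> B" and y: "y \<in> B" for x y
  proof (rule uniq)
    have "(x + y) * e - (\<xi> x + \<xi> y) *\<^sub>C e = (x * e - \<xi> x *\<^sub>C e) + (y * e - \<xi> y *\<^sub>C e)"
      by (simp add: distrib_right scaleC_add_left)
    then show "p ((x + y) * e - (\<xi> x + \<xi> y) *\<^sub>C e) = 0"
      using \<xi> x y e by (simp add: zero closed)
  qed (use x y closed in auto)
  have mult': "\<xi> (x * y) = \<xi> x * \<xi> y" if x: "x \<in> B" and y: "y \<in> B" for x y
  proof (rule uniq)
    have eq: "x * y * e - (\<xi> x * \<xi> y) *\<^sub>C e
        = x * (y * e - \<xi> y *\<^sub>C e) + \<xi> y *\<^sub>C (x * e - \<xi> x *\<^sub>C e)"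
      using scaleC_add_right[of "\<xi> y" "x * e - \<xi> x *\<^sub>C e" "\<xi> x *\<^sub>C e"]
      by (simp add: scaleC_scaleC mult_scaleC_right right_diff_distrib mult.assoc mult.commute)
    have "p (x * (y * e - \<xi> y *\<^sub>C e) + \<xi> y *\<^sub>C (x * e - \<xi> x *\<^sub>C e)) = 0"
      using \<xi> x y e by (intro zero) (simp_all add: mult scale closed)
    then show "p (x * y * e - (\<xi> x * \<xi> y) *\<^sub>C e) = 0" unfolding eq .
  qed (use x y closed in auto)
  have cmod: "cmod (\<xi> x) = p x" if x: "x \<in> B" for x
  proof -
    have "p (\<xi> x *\<^sub>C e - x * e) = 0"
      using \<xi>[OF x] p_uminus[of "x * e - \<xi> x *\<^sub>C e"] x e by (simp add: closed)
    then show ?thesis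
      using triangle_diff'[of "x * e" "\<xi> x *\<^sub>C e"] triangle_diff'[of "\<xi> x *\<^sub>C e" "x * e"] \<xi>[OF x] x e
      by (simp add: closed scale mult)
  qed
  have real: "Im (\<xi> h) = 0" if h: "h \<in> B" "h\<^sup>\<star> = h" for h
  proof -
    have ineq: "(Im (\<xi> h) + t)\<^sup>2 \<le> (norm h)\<^sup>2 + t\<^sup>2" for t
    proof -
      let ?c = "\<i> * complex_of_real t"
      have "\<xi> (h * a + ?c *\<^sub>C a) = (\<xi> h + ?c) * \<xi> a"
        using h a by (simp add: add mult' scaleC closed distrib_right)
      then have "cmod (\<xi> h + ?c) * norm a \<le> sqrt ((norm h)\<^sup>2 + t\<^sup>2) * norm a"
        using cmod[of "h * a + ?c *\<^sub>C a"] le_norm[of "h * a + ?c *\<^sub>C a"] cmod[OF a(1)] p(2) h a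
          norm_self_adjoint_shift[OF h(2), of a t]
        by (simp add: closed norm_mult)
      then have "cmod (\<xi> h + ?c) \<le> sqrt ((norm h)\<^sup>2 + t\<^sup>2)" using a by simp
      moreover have "\<bar>Im (\<xi> h) + t\<bar> \<le> cmod (\<xi> h + ?c)"
        using abs_Im_le_cmod[of "\<xi> h + ?c"] by simp
      ultimately have "\<bar>Im (\<xi> h) + t\<bar> \<le> sqrt ((norm h)\<^sup>2 + t\<^sup>2)" by linarith
      then show ?thesis by (metis abs_ge_zero power2_abs power_mono real_sqrt_pow2
            add_nonneg_nonneg zero_le_power2)
    qed
    show ?thesis
    proof (rule ccontr)
      define b where "b = Im (\<xi> h)"
      \<comment> \<open>Chosen so that the cross term 2 b t of (b + t)^2 exceeds the square of
        \<open>norm h\<close> by 1, which breaks the bound.\<close>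
      define t where "t = ((norm h)\<^sup>2 + 1) / (2 * b)"
      assume "Im (\<xi> h) \<noteq> 0"
      then have "2 * b * t = (norm h)\<^sup>2 + 1" by (simp add: b_def t_def)
      then have "(b + t)\<^sup>2 = b\<^sup>2 + ((norm h)\<^sup>2 + 1) + t\<^sup>2" by (simp add: power2_sum)
      with ineq[of t] show False unfolding b_def[symmetric] by (smt (verit) zero_le_power2)
    qed
  qed
  have star: "\<xi> (x\<^sup>\<star>) = cnj (\<xi> x)" if x: "x \<in> B" for x
  proof -
    have s: "x\<^sup>\<star> \<in> B" using star_closed[OF x] .
    have "Im (\<xi> (x + x\<^sup>\<star>)) = 0"
      by (rule real) (use x s in \<open>simp_all add: closed star_add star_star add.commute\<close>)
    moreover have "Im (\<xi> (\<i> *\<^sub>C x + (- \<i>) *\<^sub>C x\<^sup>\<star>)) = 0"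
      by (rule real) (use x s in \<open>simp_all add: closed star_add star_scaleC star_star add.commute\<close>)
    ultimately show ?thesis using x s by (simp add: add scaleC closed complex_eq_iff)
  qed
  have scaleR: "\<xi> (r *\<^sub>R x) = of_real r * \<xi> x" if "x \<in> B" for r x
    using scaleC[OF that, of "of_real r"] by (simp add: scaleC_of_real)
  have "star_character B \<xi>"
    unfolding star_character_def
    using add scaleR mult' star cmod le_norm by simp
  moreover have "cmod (\<xi> a) = norm a" using cmod[OF a(1)] p(2) by simp
  ultimately show ?thesis by blast
qed

text \<open>The sum of \<open>A\<close> and its multiple by \<i> need not be direct, hence a set of
  sums rather than pairs. Norm-closedness is not part of the locale, so algebraic checks
  suffice.\<close>

lemma complexification_comm_star_subalgebra:
  assumes "commutative_real_cstar_algebra A"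
  shows "comm_star_subalgebra {x + \<i> *\<^sub>C y |x y. x \<in> A \<and> y \<in> A}" (is "comm_star_subalgebra ?B")
proof -
  have A: "subspace A" "\<And>x y. x \<in> A \<Longrightarrow> y \<in> A \<Longrightarrow> x * y \<in> A" "\<And>x. x \<in> A \<Longrightarrow> x\<^sup>\<star> \<in> A"
    "\<And>x y. x \<in> A \<Longrightarrow> y \<in> A \<Longrightarrow> x * y = y * x"
    using assms by (auto simp: commutative_real_cstar_algebra_def real_cstar_algebra_def)
  note sub = subspace_add[OF A(1)] subspace_diff[OF A(1)] subspace_scale[OF A(1)] subspace_neg[OF A(1)]
  have mult: "(x + \<i> *\<^sub>C y) * (u + \<i> *\<^sub>C v) = (x * u - y * v) + \<i> *\<^sub>C (x * v + y * u)" for x y u v :: 'a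
    by (simp add: distrib_left distrib_right mult_scaleC_left mult_scaleC_right scaleC_scaleC
        scaleC_minus_left scaleC_add_right)
  have scale: "c *\<^sub>C (x + \<i> *\<^sub>C y)
      = (Re c *\<^sub>R x - Im c *\<^sub>R y) + \<i> *\<^sub>C (Im c *\<^sub>R x + Re c *\<^sub>R y)" for c and x y :: 'a
  proof -
    have dec: "d *\<^sub>C z = Re d *\<^sub>R z + \<i> *\<^sub>C (Im d *\<^sub>R z)" for d and z :: 'a
      by (simp only: scaleC_of_real[symmetric] scaleC_scaleC scaleC_add_left[symmetric]
          complex_eq[symmetric])
    show ?thesis
      using dec[of c x] dec[of "c * \<i>" y] by (simp add: scaleC_add_right scaleC_scaleC)
  qed
  have inB: "x + \<i> *\<^sub>C y \<in> ?B" if "x \<in> A" "y \<in> A" for x y using that by blast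
  have star: "(x + \<i> *\<^sub>C y)\<^sup>\<star> = x\<^sup>\<star> + \<i> *\<^sub>C (- y\<^sup>\<star>)" for x y :: 'a
    using scaleC_scaleC[of \<i> "-1" "y\<^sup>\<star>"]
    by (simp add: star_add star_scaleC scaleC_minus_left)
  show ?thesis
  proof
    fix z w assume "z \<in> ?B" "w \<in> ?B"
    then obtain x y u v where xy: "x \<in> A" "y \<in> A" "u \<in> A" "v \<in> A"
      and z: "z = x + \<i> *\<^sub>C y" and w: "w = u + \<i> *\<^sub>C v" by blast
    have "z + w = (x + u) + \<i> *\<^sub>C (y + v)" by (simp add: z w scaleC_add_right)
    then show "z + w \<in> ?B" using inB[of "x + u" "y + v"] xy sub by simp
    show "z * w \<in> ?B" unfolding z w mult by (intro inB) (simp_all add: xy sub A(2))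
    show "z * w = w * z"
      unfolding z w mult A(4)[OF xy(3,1)] A(4)[OF xy(4,2)] A(4)[OF xy(3,2)] A(4)[OF xy(4,1)]
      by (simp only: add.commute)
  next
    fix z c assume "z \<in> ?B"
    then obtain x y where xy: "x \<in> A" "y \<in> A" and z: "z = x + \<i> *\<^sub>C y" by blast
    show "c *\<^sub>C z \<in> ?B" unfolding z scale by (intro inB) (simp_all add: xy sub)
    show "z\<^sup>\<star> \<in> ?B" unfolding z star by (intro inB) (simp_all add: xy sub A(3))
  qed
qed

lemma star_character_exists_real:
  assumes A: "commutative_real_cstar_algebra A" and a: "a \<in> A" "a \<noteq> 0"
  shows "\<exists>\<xi>. star_character A \<xi> \<and> cmod (\<xi> a) = norm a"
proof -
  define B where "B = {x + \<i> *\<^sub>C y |x y. x \<in> A \<and> y \<in> A}"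
  interpret comm_star_subalgebra B
    unfolding B_def by (rule complexification_comm_star_subalgebra[OF A])
  have "0 \<in> A" using A by (simp add: commutative_real_cstar_algebra_def real_cstar_algebra_def subspace_0)
  then have sub: "x \<in> B" if "x \<in> A" for x using that by (force simp: B_def)
  then obtain \<xi> where "star_character B \<xi>" "cmod (\<xi> a) = norm a"
    using star_character_exists a by blast
  with sub show ?thesis unfolding star_character_def by (intro exI[of _ \<xi>]) simp
qed

section \<open>Multipliers\<close>

locale comm_real_cstar =
  fixes A :: "'a::complex_cstar_algebra set"
  assumes A: "commutative_real_cstar_algebra A"
begin

lemma subspace: "subspace A"
  using A by (simp add: commutative_real_cstar_algebra_def real_cstar_algebra_def)

lemma closed_A: "closed A"
  using A by (simp add: commutative_real_cstar_algebra_def real_cstar_algebra_def)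

lemma mult_closed: "x \<in> A \<Longrightarrow> y \<in> A \<Longrightarrow> x * y \<in> A"
  using A by (simp add: commutative_real_cstar_algebra_def real_cstar_algebra_def)

lemma star_closed: "x \<in> A \<Longrightarrow> x\<^sup>\<star> \<in> A"
  using A by (simp add: commutative_real_cstar_algebra_def real_cstar_algebra_def)

lemma commute: "x \<in> A \<Longrightarrow> y \<in> A \<Longrightarrow> x * y = y * x"
  using A by (simp add: commutative_real_cstar_algebra_def)

lemmas closed = mult_closed star_closed subspace_add[OF subspace] subspace_diff[OF subspace]
  subspace_scale[OF subspace] subspace_neg[OF subspace] subspace_0[OF subspace]

lemma sum_closed: "(\<And>i. i \<in> I \<Longrightarrow> x i \<in> A) \<Longrightarrow> (\<Sum>i\<in>I. x i) \<in> A"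
  by (rule subspace_sum[OF subspace])

definition X :: "('a \<Rightarrow> complex) set" where "X = {f. star_character A f}"

context
  fixes f assumes f: "f \<in> X"
begin

lemma ev_add: "x \<in> A \<Longrightarrow> y \<in> A \<Longrightarrow> f (x + y) = f x + f y"
  using f by (simp add: X_def star_character_def)

lemma ev_scaleR: "x \<in> A \<Longrightarrow> f (r *\<^sub>R x) = of_real r * f x"
  using f by (simp add: X_def star_character_def)

lemma ev_mult: "x \<in> A \<Longrightarrow> y \<in> A \<Longrightarrow> f (x * y) = f x * f y"
  using f by (simp add: X_def star_character_def)

lemma ev_star: "x \<in> A \<Longrightarrow> f (x\<^sup>\<star>) = cnj (f x)"
  using f by (simp add: X_def star_character_def)

lemma ev_le_norm: "x \<in> A \<Longrightarrow> cmod (f x) \<le> norm x"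
  using f by (simp add: X_def star_character_def)

lemma ev_zero: "f 0 = 0"
  using ev_scaleR[of 0 0] closed by simp

lemma ev_uminus: "x \<in> A \<Longrightarrow> f (- x) = - f x"
  using ev_scaleR[of x "-1"] by simp

lemma ev_diff: "x \<in> A \<Longrightarrow> y \<in> A \<Longrightarrow> f (x - y) = f x - f y"
  using ev_add[of x "-y"] ev_uminus closed by simp

lemma ev_sum: "(\<And>i. i \<in> I \<Longrightarrow> x i \<in> A) \<Longrightarrow> f (\<Sum>i\<in>I. x i) = (\<Sum>i\<in>I. f (x i))"
  by (induction I rule: infinite_finite_induct) (auto simp: ev_zero ev_add sum_closed)

end

lemmas ev = ev_add ev_scaleR ev_mult ev_star ev_zero ev_uminus ev_diff ev_sum

lemma norm_leI:
  assumes "x \<in> A" "0 \<le> c" "\<And>f. f \<in> X \<Longrightarrow> cmod (f x) \<le> c"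
  shows "norm x \<le> c"
proof (cases "x = 0")
  case False
  then obtain f where "f \<in> X" "cmod (f x) = norm x"
    using star_character_exists_real[OF A assms(1)] by (auto simp: X_def)
  then show ?thesis using assms(3) by metis
qed (use assms in simp)

lemma eqI:
  assumes "x \<in> A" "y \<in> A" "\<And>f. f \<in> X \<Longrightarrow> f x = f y"
  shows "x = y"
  using norm_leI[of "x - y" 0] assms closed by (simp add: ev)

text \<open>These play the role of the bounded continuous real functions on the spectrum. No
  topology is put on \<open>X\<close>: continuity is replaced by the demand that multiplication
  preserve \<open>A\<close>.\<close>

definition multiplier :: "(('a \<Rightarrow> complex) \<Rightarrow> real) \<Rightarrow> bool" where
  "multiplier m \<longleftrightarrow> (\<exists>K. \<forall>f\<in>X. \<bar>m f\<bar> \<le> K) \<and>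
     (\<forall>x\<in>A. \<exists>y\<in>A. \<forall>f\<in>X. f y = of_real (m f) * f x)"

definition act :: "(('a \<Rightarrow> complex) \<Rightarrow> real) \<Rightarrow> 'a \<Rightarrow> 'a" where
  "act m x = (THE y. y \<in> A \<and> (\<forall>f\<in>X. f y = of_real (m f) * f x))"

lemma act:
  assumes "multiplier m" "x \<in> A"
  shows act_closed: "act m x \<in> A" and ev_act: "f \<in> X \<Longrightarrow> f (act m x) = of_real (m f) * f x"
proof -
  obtain y where y: "y \<in> A \<and> (\<forall>f\<in>X. f y = of_real (m f) * f x)"
    using assms unfolding multiplier_def by blast
  have "act m x \<in> A \<and> (\<forall>f\<in>X. f (act m x) = of_real (m f) * f x)"
    unfolding act_def by (rule theI[where a = y]) (use y in \<open>auto intro: eqI\<close>)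
  then show "act m x \<in> A" "f \<in> X \<Longrightarrow> f (act m x) = of_real (m f) * f x" by auto
qed

lemma act_eqI:
  assumes "multiplier m" "x \<in> A" "y \<in> A" "\<And>f. f \<in> X \<Longrightarrow> f y = of_real (m f) * f x"
  shows "act m x = y"
  by (rule eqI) (use assms in \<open>auto simp: act\<close>)

lemma norm_act_le:
  assumes "multiplier m" "x \<in> A" "0 \<le> K" "\<And>f. f \<in> X \<Longrightarrow> \<bar>m f\<bar> \<le> K"
  shows "norm (act m x) \<le> K * norm x"
  by (rule norm_leI) (use assms in \<open>auto simp: act norm_mult intro!: mult_mono ev_le_norm\<close>)

lemma multiplier_bounded:
  assumes "multiplier m"
  obtains K where "K > 0" "\<And>f. f \<in> X \<Longrightarrow> \<bar>m f\<bar> \<le> K"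
proof -
  obtain K where K: "\<And>f. f \<in> X \<Longrightarrow> \<bar>m f\<bar> \<le> K" using assms by (auto simp: multiplier_def)
  show thesis by (rule that[of "max K 1"]) (use K in fastforce)+
qed

lemma multiplierI:
  assumes "\<And>f. f \<in> X \<Longrightarrow> \<bar>m f\<bar> \<le> K"
    and "\<And>x. x \<in> A \<Longrightarrow> y x \<in> A"
    and "\<And>x f. x \<in> A \<Longrightarrow> f \<in> X \<Longrightarrow> f (y x) = of_real (m f) * f x"
  shows "multiplier m"
  using assms unfolding multiplier_def by blast

lemma multiplier_const: "multiplier (\<lambda>_. c)"
  by (rule multiplierI[of _ "\<bar>c\<bar>" "\<lambda>x. c *\<^sub>R x"]) (simp_all add: ev closed)

lemma multiplier_add:
  assumes "multiplier m" "multiplier n"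
  shows "multiplier (\<lambda>f. m f + n f)"
proof -
  obtain K L where "\<And>f. f \<in> X \<Longrightarrow> \<bar>m f\<bar> \<le> K" "\<And>f. f \<in> X \<Longrightarrow> \<bar>n f\<bar> \<le> L"
    using assms multiplier_bounded by metis
  then have "\<bar>m f + n f\<bar> \<le> K + L" if "f \<in> X" for f using that by (meson abs_triangle_ineq add_mono order_trans)
  then show ?thesis
    by (rule multiplierI[where y = "\<lambda>x. act m x + act n x"])
      (use assms in \<open>simp_all add: act ev closed distrib_right\<close>)
qed

lemma multiplier_mult:
  assumes "multiplier m" "multiplier n"
  shows "multiplier (\<lambda>f. m f * n f)"
proof -
  obtain K L where "\<And>f. f \<in> X \<Longrightarrow> \<bar>m f\<bar> \<le> K" "K > 0" "\<And>f. f \<in> X \<Longrightarrow> \<bar>n f\<bar> \<le> L"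
    using assms multiplier_bounded by metis
  then have "\<bar>m f * n f\<bar> \<le> K * L" if "f \<in> X" for f using that by (auto simp: abs_mult intro!: mult_mono)
  then show ?thesis
    by (rule multiplierI[where y = "\<lambda>x. act m (act n x)"]) (use assms in \<open>simp_all add: act\<close>)
qed

lemma multiplier_scale: "multiplier m \<Longrightarrow> multiplier (\<lambda>f. c * m f)"
  by (intro multiplier_mult multiplier_const)

lemma multiplier_sum: "(\<And>i. i \<in> I \<Longrightarrow> multiplier (m i)) \<Longrightarrow> multiplier (\<lambda>f. \<Sum>i\<in>I. m i f)"
  by (induction I rule: infinite_finite_induct) (auto intro: multiplier_const multiplier_add)

lemma multiplier_Re:
  assumes "h \<in> A" "h\<^sup>\<star> = h"
  shows "multiplier (\<lambda>f. Re (f h))" "f \<in> X \<Longrightarrow> f h = of_real (Re (f h))"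
proof -
  show *: "f h = of_real (Re (f h))" if "f \<in> X" for f
    using ev_star[OF that assms(1)] assms(2) by (simp add: complex_eq_iff)
  show "multiplier (\<lambda>f. Re (f h))"
  proof (rule multiplierI[where y = "\<lambda>x. h * x"])
    show "\<bar>Re (f h)\<bar> \<le> norm h" if "f \<in> X" for f
      using abs_Re_le_cmod[of "f h"] ev_le_norm[OF that assms(1)] by linarith
    show "f (h * x) = of_real (Re (f h)) * f x" if "x \<in> A" "f \<in> X" for x f
      using *[OF that(2)] ev_mult[OF that(2) assms(1) that(1)] by simp
  qed (use assms closed in simp)
qed

text \<open>Norms in \<open>A\<close> are computed by characters, so uniform closeness of the
  functions makes their actions on \<open>x\<close> a Cauchy sequence. Completeness of the ambient
  algebra provides the limit, and closedness keeps it in \<open>A\<close>.\<close>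

lemma multiplier_uniform_limit:
  assumes "\<And>e. e > 0 \<Longrightarrow> \<exists>n. multiplier n \<and> (\<forall>f\<in>X. \<bar>m f - n f\<bar> \<le> e)"
  shows "multiplier m"
proof -
  have "\<forall>k. \<exists>n. multiplier n \<and> (\<forall>f\<in>X. \<bar>m f - n f\<bar> \<le> 1 / real (Suc k))"
    using assms by simp
  then obtain n where n: "\<And>k. multiplier (n k)"
    and near: "\<And>k f. f \<in> X \<Longrightarrow> \<bar>m f - n k f\<bar> \<le> 1 / real (Suc k)" by metis
  have inv: "(\<lambda>k. 1 / real (Suc k)) \<longlonglongrightarrow> 0"
    using LIMSEQ_inverse_real_of_nat by (simp add: inverse_eq_divide)
  obtain K where K: "\<And>f. f \<in> X \<Longrightarrow> \<bar>n 0 f\<bar> \<le> K" using multiplier_bounded[OF n] by metis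
  have "\<exists>y\<in>A. \<forall>f\<in>X. f y = of_real (m f) * f x" if x: "x \<in> A" for x
  proof -
    define y where "y k = act (n k) x" for k
    have y: "y k \<in> A" for k using n x by (simp add: y_def act)
    have diff: "norm (y k - y l) \<le> (1 / real (Suc k) + 1 / real (Suc l)) * norm x" for k l
    proof (rule norm_leI)
      fix f assume f: "f \<in> X"
      have "f (y k - y l) = of_real (n k f - n l f) * f x"
        using n x y f by (simp add: ev) (simp add: y_def act left_diff_distrib)
      moreover have "\<bar>n k f - n l f\<bar> \<le> 1 / real (Suc k) + 1 / real (Suc l)"
        using near[OF f, of k] near[OF f, of l] by linarith
      ultimately show "cmod (f (y k - y l)) \<le> (1 / real (Suc k) + 1 / real (Suc l)) * norm x"
        using ev_le_norm[OF f x] by (simp only: norm_mult norm_of_real) (intro mult_mono; simp)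
    qed (use y closed in auto)
    have "Cauchy y"
    proof (rule metric_CauchyI)
      fix e :: real assume "e > 0"
      have "(\<lambda>k. (1 / real (Suc k) + 1 / real (Suc k)) * norm x) \<longlonglongrightarrow> (0 + 0) * norm x"
        by (intro tendsto_intros inv)
      then have "\<forall>\<^sub>F k in sequentially. (1 / real (Suc k) + 1 / real (Suc k)) * norm x < e"
        using \<open>e > 0\<close> by (intro order_tendstoD(2)) simp_all
      then obtain M where M: "(1 / real (Suc M) + 1 / real (Suc M)) * norm x < e"
        using eventually_happens'[OF sequentially_bot] by blast
      have "dist (y k) (y l) < e" if "k \<ge> M" "l \<ge> M" for k l
      proof -
        have "1 / real (Suc k) \<le> 1 / real (Suc M)" "1 / real (Suc l) \<le> 1 / real (Suc M)"
          using that by (auto simp: frac_le)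
        then have "(1 / real (Suc k) + 1 / real (Suc l)) * norm x
            \<le> (1 / real (Suc M) + 1 / real (Suc M)) * norm x"
          by (intro mult_right_mono add_mono) auto
        then show ?thesis using diff[of k l] M by (simp add: dist_norm)
      qed
      then show "\<exists>M. \<forall>k\<ge>M. \<forall>l\<ge>M. dist (y k) (y l) < e" by blast
    qed
    then obtain z where z: "y \<longlonglongrightarrow> z" using Cauchy_convergent convergent_def by blast
    have zA: "z \<in> A" using closed_sequentially[OF closed_A y z] .
    have "f z = of_real (m f) * f x" if f: "f \<in> X" for f
    proof (rule LIMSEQ_unique)
      have "(\<lambda>k. f (y k) - f z) \<longlonglongrightarrow> 0"
      proof (rule Lim_null_comparison)
        show "\<forall>\<^sub>F k in sequentially. norm (f (y k) - f z) \<le> norm (y k - z)"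
          using ev_le_norm[OF f] y zA closed by (simp add: ev_diff[OF f y zA, symmetric])
        show "(\<lambda>k. norm (y k - z)) \<longlonglongrightarrow> 0" using z by (simp add: LIM_zero tendsto_norm_zero)
      qed
      then show "(\<lambda>k. f (y k)) \<longlonglongrightarrow> f z" by (simp add: LIM_zero_cancel)
      have "(\<lambda>k. n k f - m f) \<longlonglongrightarrow> 0"
        by (rule Lim_null_comparison[OF _ inv]) (use near[OF f] in \<open>simp add: abs_minus_commute\<close>)
      then have "(\<lambda>k. n k f) \<longlonglongrightarrow> m f" by (simp add: LIM_zero_cancel)
      then have "(\<lambda>k. of_real (n k f) * f x) \<longlonglongrightarrow> of_real (m f) * f x"
        by (intro tendsto_intros)
      then show "(\<lambda>k. f (y k)) \<longlonglongrightarrow> of_real (m f) * f x"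
        using n x f by (simp add: y_def act)
    qed
    then show ?thesis using zA by blast
  qed
  moreover have "\<bar>m f\<bar> \<le> K + 1" if "f \<in> X" for f
    using K[OF that] near[OF that, of 0] by simp
  ultimately show ?thesis unfolding multiplier_def by blast
qed

text \<open>The continuous functions \<open>h\<close> for which \<open>h\<close> composed with
  \<open>m\<close> is a multiplier form an algebra containing the constants and the identity. By
  Stone-Weierstrass they approximate \<open>g\<close> uniformly on an interval containing the values
  of \<open>m\<close>.\<close>

lemma multiplier_continuous:
  assumes m: "multiplier m" and g: "continuous_on UNIV (g :: real \<Rightarrow> real)"
  shows "multiplier (\<lambda>f. g (m f))"
proof -
  obtain K where K: "\<And>f. f \<in> X \<Longrightarrow> \<bar>m f\<bar> \<le> K" using m multiplier_bounded by metis
  define R where "R = {h. continuous_on UNIV h \<and> multiplier (\<lambda>f. h (m f))}"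
  interpret function_ring_on R "{-K..K}"
  proof
    show "\<exists>h\<in>R. h x \<noteq> h y" if "x \<noteq> y" for x y
      by (rule bexI[of _ "\<lambda>x. x"]) (use that m in \<open>auto simp: R_def\<close>)
  qed (auto simp: R_def intro: multiplier_add multiplier_mult multiplier_const
      intro!: continuous_intros elim: continuous_on_subset)
  show ?thesis
  proof (rule multiplier_uniform_limit)
    fix e :: real assume "e > 0"
    have "continuous_on {-K..K} g" using g continuous_on_subset by blast
    then obtain h where h: "h \<in> R" "\<And>t. t \<in> {-K..K} \<Longrightarrow> \<bar>g t - h t\<bar> < e"
      using Stone_Weierstrass_basic[of g e] \<open>e > 0\<close> by blast
    have "\<bar>g (m f) - h (m f)\<bar> \<le> e" if "f \<in> X" for f
    proof -
      have "m f \<in> {-K..K}" using K[OF that] by (simp add: abs_le_iff)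
      then show ?thesis by (intro less_imp_le h(2))
    qed
    then show "\<exists>n. multiplier n \<and> (\<forall>f\<in>X. \<bar>g (m f) - n f\<bar> \<le> e)"
      using h(1) by (intro exI[of _ "\<lambda>f. h (m f)"]) (auto simp: R_def)
  qed
qed

lemma multiplier_cong: "multiplier m \<Longrightarrow> (\<And>f. f \<in> X \<Longrightarrow> m f = n f) \<Longrightarrow> multiplier n"
  by (simp add: multiplier_def)

lemma multiplier_divide:
  assumes m: "multiplier m" and n: "multiplier n" and "d > 0" "\<And>f. f \<in> X \<Longrightarrow> d \<le> n f"
  shows "multiplier (\<lambda>f. m f / n f)"
proof -
  \<comment> \<open>Cutting off at the lower bound \<open>d\<close> makes the reciprocal continuous
    on the whole line without changing it on the values of \<open>n\<close>.\<close>
  have "continuous_on UNIV (\<lambda>t. 1 / max t d)"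
    using \<open>d > 0\<close> by (intro continuous_intros) auto
  from multiplier_mult[OF m multiplier_continuous[OF n this]]
  show ?thesis by (rule multiplier_cong) (use assms(4) in \<open>simp add: max_absorb1\<close>)
qed

lemma act_sum:
  assumes "\<And>i. i \<in> I \<Longrightarrow> multiplier (m i)" "x \<in> A"
  shows "act (\<lambda>f. \<Sum>i\<in>I. m i f) x = (\<Sum>i\<in>I. act (m i) x)"
  by (rule act_eqI)
    (use assms in \<open>auto simp: ev act sum_distrib_right intro!: multiplier_sum sum_closed\<close>)

lemma act_scale:
  assumes "multiplier m" "x \<in> A"
  shows "act (\<lambda>f. c * m f) x = c *\<^sub>R act m x"
  by (rule act_eqI) (use assms in \<open>auto simp: ev act closed intro: multiplier_scale\<close>)

end

section \<open>Orthogonal forms are balanced over the multipliers\<close>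

text \<open>The nodal functions of piecewise linear interpolation at the integers. On [0, n] they
  reproduce both the constant 1 and the identity exactly, so decomposing along them leaves no
  remainder.\<close>

definition hat :: "nat \<Rightarrow> real \<Rightarrow> real" where
  "hat j u = max 0 (1 - \<bar>u - real j\<bar>)"

lemma hat_nonneg: "0 \<le> hat j u"
  by (simp add: hat_def)

lemma hat_mult_eq_0: "j + 1 < k \<or> k + 1 < j \<Longrightarrow> hat j u * hat k u = 0"
  by (auto simp: hat_def max_def abs_if)

lemma continuous_hat: "continuous_on S (hat j)"
  unfolding hat_def by (intro continuous_intros)

text \<open>The applications have \<open>u \<le> real n\<close>; the values beyond it, here and in
  the next lemma, are what the induction on \<open>n\<close> needs.\<close>

lemma sum_hat:
  assumes "0 \<le> u"
  shows "(\<Sum>j\<le>n. hat j u) = min 1 (max 0 (real n + 1 - u))"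
proof (induction n)
  case (Suc n)
  then show ?case using assms by (auto simp: hat_def min_def max_def abs_if)
qed (use assms in \<open>auto simp: hat_def\<close>)

lemma sum_index_hat:
  assumes "0 \<le> u"
  shows "(\<Sum>j\<le>n. real j * hat j u) = (if u \<le> real n then u else real n * max 0 (real n + 1 - u))"
proof (induction n)
  case (Suc n)
  consider "u \<le> real n" | "real n < u" "u \<le> real n + 1" | "real n + 1 < u" by linarith
  then show ?case
  proof cases
    case 2
    then show ?thesis using Suc by (simp add: hat_def) (simp add: algebra_simps)
  qed (use Suc in \<open>simp_all add: hat_def\<close>)
qed (use assms in simp)

text \<open>
  For adjacent indices this is their difference. As it depends only on residues modulo 3, the sum over
  all pairs of hats collapses to nine terms, with a bound that does not grow with the number of hats.
\<close>

definition step3 :: "nat \<Rightarrow> nat \<Rightarrow> real" where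
  "step3 r s = (if r = s then 0 else if r = Suc s mod 3 then 1 else - 1)"

lemma step3_adjacent:
  assumes "j \<le> k + 1" "k \<le> j + 1"
  shows "step3 (j mod 3) (k mod 3) = real j - real k"
proof -
  consider "j = k" | "j = Suc k" | "k = Suc j" using assms by linarith
  then show ?thesis
  proof cases
    case 2
    moreover have "Suc k mod 3 \<noteq> k mod 3" by presburger
    ultimately show ?thesis by (simp add: step3_def mod_Suc_eq)
  next
    case 3
    moreover have "Suc j mod 3 \<noteq> j mod 3" "Suc (Suc j) mod 3 \<noteq> j mod 3" by presburger+
    ultimately show ?thesis by (simp add: step3_def mod_Suc_eq)
  qed (simp add: step3_def)
qed

locale orthogonal_form = comm_real_cstar A for A :: "'a::complex_cstar_algebra set" +
  fixes V :: "'a \<Rightarrow> 'a \<Rightarrow> real" and C :: real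
  assumes orth: "orthogonal_form_on A V" and C: "0 \<le> C"
    and bound: "x \<in> A \<Longrightarrow> y \<in> A \<Longrightarrow> \<bar>V x y\<bar> \<le> C * norm x * norm y"
begin

lemma V_add_left: "x \<in> A \<Longrightarrow> x' \<in> A \<Longrightarrow> y \<in> A \<Longrightarrow> V (x + x') y = V x y + V x' y"
  using orth by (simp add: orthogonal_form_on_def bilinear_form_on_def real_linear_on_def)

lemma V_add_right: "x \<in> A \<Longrightarrow> y \<in> A \<Longrightarrow> y' \<in> A \<Longrightarrow> V x (y + y') = V x y + V x y'"
  using orth by (simp add: orthogonal_form_on_def bilinear_form_on_def real_linear_on_def)

lemma V_scale_left: "x \<in> A \<Longrightarrow> y \<in> A \<Longrightarrow> V (r *\<^sub>R x) y = r * V x y"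
  using orth by (simp add: orthogonal_form_on_def bilinear_form_on_def real_linear_on_def)

lemma V_scale_right: "x \<in> A \<Longrightarrow> y \<in> A \<Longrightarrow> V x (r *\<^sub>R y) = r * V x y"
  using orth by (simp add: orthogonal_form_on_def bilinear_form_on_def real_linear_on_def)

lemma V_diff_left: "x \<in> A \<Longrightarrow> x' \<in> A \<Longrightarrow> y \<in> A \<Longrightarrow> V (x - x') y = V x y - V x' y"
  using V_add_left[of x "(-1) *\<^sub>R x'" y] V_scale_left[of x' y "-1"] closed(5)[of x' "-1"] by simp

lemma V_sum_left:
  assumes "\<And>i. i \<in> I \<Longrightarrow> x i \<in> A" "y \<in> A"
  shows "V (\<Sum>i\<in>I. x i) y = (\<Sum>i\<in>I. V (x i) y)"
  using assms V_scale_left[of 0 y 0] closed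
  by (induction I rule: infinite_finite_induct) (simp_all add: V_add_left sum_closed)

lemma V_sum_right:
  assumes "\<And>i. i \<in> I \<Longrightarrow> y i \<in> A" "x \<in> A"
  shows "V x (\<Sum>i\<in>I. y i) = (\<Sum>i\<in>I. V x (y i))"
  using assms V_scale_right[of x 0 0] closed
  by (induction I rule: infinite_finite_induct) (simp_all add: V_add_right sum_closed)

lemma V_act_eq_0:
  assumes m: "multiplier m" "multiplier n" "\<And>f. f \<in> X \<Longrightarrow> m f * n f = 0" and xy: "x \<in> A" "y \<in> A"
  shows "V (act m x) (act n y) = 0"
proof -
  note a = act_closed[OF m(1) xy(1)] act_closed[OF m(2) xy(2)]
  have "f (act m x * (act n y)\<^sup>\<star>) = 0" if "f \<in> X" for f
    using m(3)[OF that] that m xy a by (auto simp: ev closed ev_act)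
  then have "act m x * (act n y)\<^sup>\<star> = 0" using a by (intro eqI) (auto simp: closed ev)
  then show ?thesis
    using orth a commute[OF a(1) star_closed[OF a(2)]]
    by (simp add: orthogonal_form_on_def cstar_orthogonal_def)
qed

text \<open>The factor \<open>real n\<close> is the gain: the defect times n is exactly a sum
  weighted by differences of hat indices, while the right-hand side does not depend on n. The 9
  counts the pairs of residue classes modulo 3.\<close>

lemma balanced_aux:
  assumes m: "multiplier m" "\<And>f. f \<in> X \<Longrightarrow> 0 \<le> m f" "\<And>f. f \<in> X \<Longrightarrow> m f \<le> 1"
    and xy: "x \<in> A" "y \<in> A"
  shows "real n * \<bar>V (act m x) y - V x (act m y)\<bar> \<le> 9 * (C * norm x * norm y)"
proof -
  define e where "e j f = hat j (real n * m f)" for j f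
  have e: "multiplier (e j)" for j
    unfolding e_def by (intro multiplier_continuous[OF multiplier_scale[OF m(1)]] continuous_hat)
  have range: "0 \<le> real n * m f" "real n * m f \<le> real n" if "f \<in> X" for f
    using m that by (auto simp: mult_left_le)
  have one: "(\<Sum>j\<le>n. e j f) = 1" if "f \<in> X" for f
    using range[OF that] by (simp add: e_def sum_hat)
  have idx: "(\<Sum>j\<le>n. real j * e j f) = real n * m f" if "f \<in> X" for f
    using range[OF that] by (simp add: e_def sum_index_hat)
  define E where "E j z = act (e j) z" for j z
  have E: "E j z \<in> A" if "z \<in> A" for j z using act_closed[OF e that] by (simp add: E_def)
  have id: "z = (\<Sum>j\<le>n. E j z)" if "z \<in> A" for z
    using that by (intro eqI)
      (simp_all add: E sum_closed ev_sum, simp_all add: E_def ev_act[OF e] flip: sum_distrib_right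
        of_real_sum, simp add: one)
  have m_id: "real n *\<^sub>R act m z = (\<Sum>j\<le>n. real j *\<^sub>R E j z)" if "z \<in> A" for z
  proof (rule eqI)
    fix f assume f: "f \<in> X"
    have "f (\<Sum>j\<le>n. real j *\<^sub>R E j z) = of_real (\<Sum>j\<le>n. real j * e j f) * f z"
      using f that E by (simp add: ev_sum ev_scaleR closed sum_distrib_right)
        (simp add: E_def ev_act[OF e] mult.assoc)
    then show "f (real n *\<^sub>R act m z) = f (\<Sum>j\<le>n. real j *\<^sub>R E j z)"
      using f that m(1) by (simp add: idx ev_scaleR act)
  qed (use that m E in \<open>simp_all add: act closed sum_closed\<close>)
  define B where "B j k = V (E j x) (E k y)" for j k
  have left: "real n * V (act m x) y = (\<Sum>j\<le>n. \<Sum>k\<le>n. real j * B j k)"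
  proof -
    have "real n * V (act m x) y = V (\<Sum>j\<le>n. real j *\<^sub>R E j x) y"
      using V_scale_left[of "act m x" y "real n"] act_closed[OF m(1) xy(1)] m_id[OF xy(1)] xy by simp
    also have "\<dots> = (\<Sum>j\<le>n. real j * V (E j x) (\<Sum>k\<le>n. E k y))"
      using xy E id[OF xy(2)] by (simp add: V_sum_left V_scale_left closed)
    finally show ?thesis using xy E by (simp add: V_sum_right B_def sum_distrib_left)
  qed
  have right: "real n * V x (act m y) = (\<Sum>j\<le>n. \<Sum>k\<le>n. real k * B j k)"
  proof -
    have "real n * V x (act m y) = V (\<Sum>j\<le>n. E j x) (\<Sum>k\<le>n. real k *\<^sub>R E k y)"
      using V_scale_right[of x "act m y" "real n"] act_closed[OF m(1) xy(2)] m_id[OF xy(2)] id[OF xy(1)] xy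
      by simp
    then have "real n * V x (act m y) = (\<Sum>k\<le>n. \<Sum>j\<le>n. real k * B j k)"
      using xy E
      by (simp add: V_sum_right V_sum_left V_scale_right B_def closed sum_closed sum_distrib_left)
    then show ?thesis by (subst sum.swap)
  qed
  have adjacent: "(real j - real k) * B j k = step3 (j mod 3) (k mod 3) * B j k" for j k
  proof (cases "j + 1 < k \<or> k + 1 < j")
    case True
    then have "B j k = 0"
      unfolding B_def E_def using xy e by (intro V_act_eq_0) (auto simp: e_def hat_mult_eq_0)
    then show ?thesis by simp
  qed (simp add: step3_adjacent)
  \<comment> \<open>The hats of one residue class are nonnegative with sum at most 1 at every
    character, so \<open>S r\<close> does not increase norms, however many hats it collects.\<close>
  define S where "S r z = (\<Sum>j\<in>{j\<in>{..n}. j mod 3 = r}. E j z)" for r z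
  have S: "S r z \<in> A" if "z \<in> A" for r z using E that by (simp add: S_def sum_closed)
  have norm_S: "norm (S r z) \<le> norm z" if "z \<in> A" for r z
  proof (rule norm_leI)
    fix f assume f: "f \<in> X"
    let ?s = "\<Sum>j\<in>{j\<in>{..n}. j mod 3 = r}. e j f"
    have "f (S r z) = of_real ?s * f z"
      using f that E by (simp add: S_def ev_sum sum_distrib_right) (simp add: E_def ev_act[OF e])
    moreover have "0 \<le> ?s" by (intro sum_nonneg) (simp add: e_def hat_nonneg)
    moreover have "?s \<le> (\<Sum>j\<le>n. e j f)" by (intro sum_mono2) (auto simp: e_def hat_nonneg)
    ultimately have "cmod (f (S r z)) \<le> 1 * cmod (f z)"
      using one[OF f] by (simp only: norm_mult norm_of_real) (intro mult_right_mono; simp)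
    then show "cmod (f (S r z)) \<le> norm z" using ev_le_norm[OF f that] by simp
  qed (use S that in auto)
  have residue: "(\<Sum>j\<le>n. h (j mod 3) j) = (\<Sum>r<3. \<Sum>j\<in>{j\<in>{..n}. j mod 3 = r}. h r j)"
    for h :: "nat \<Rightarrow> nat \<Rightarrow> real"
  proof -
    have "(\<Sum>r<3. \<Sum>j\<in>{j\<in>{..n}. j mod 3 = r}. h (j mod 3) j) = (\<Sum>j\<le>n. h (j mod 3) j)"
      by (rule sum.group) auto
    moreover have "(\<Sum>r<3. \<Sum>j\<in>{j\<in>{..n}. j mod 3 = r}. h (j mod 3) j)
        = (\<Sum>r<3. \<Sum>j\<in>{j\<in>{..n}. j mod 3 = r}. h r j)"
      by (intro sum.cong) auto
    ultimately show ?thesis by simp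
  qed
  have "real n * (V (act m x) y - V x (act m y)) = (\<Sum>j\<le>n. \<Sum>k\<le>n. step3 (j mod 3) (k mod 3) * B j k)"
    by (simp add: right_diff_distrib left right sum_subtractf[symmetric] left_diff_distrib[symmetric] adjacent)
  also have "\<dots> = (\<Sum>r<3. \<Sum>j\<in>{j\<in>{..n}. j mod 3 = r}. \<Sum>k\<le>n. step3 r (k mod 3) * B j k)"
    by (rule residue)
  also have "\<dots> = (\<Sum>r<3. \<Sum>j\<in>{j\<in>{..n}. j mod 3 = r}. \<Sum>s<3. \<Sum>k\<in>{k\<in>{..n}. k mod 3 = s}. step3 r s * B j k)"
    by (intro sum.cong refl residue)
  also have "\<dots> = (\<Sum>r<3. \<Sum>s<3. step3 r s * V (S r x) (S s y))"
  proof (rule sum.cong[OF refl])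
    fix r :: nat
    let ?J = "\<lambda>r. {j\<in>{..n}. j mod 3 = r}"
    have "(\<Sum>j\<in>?J r. \<Sum>s<3. \<Sum>k\<in>?J s. step3 r s * B j k)
        = (\<Sum>s<3. \<Sum>j\<in>?J r. \<Sum>k\<in>?J s. step3 r s * B j k)" by (rule sum.swap)
    also have "\<dots> = (\<Sum>s<3. step3 r s * V (S r x) (S s y))"
    proof (rule sum.cong[OF refl])
      fix s :: nat
      have "V (S r x) (S s y) = (\<Sum>j\<in>?J r. \<Sum>k\<in>?J s. B j k)"
        unfolding S_def B_def using xy E
        by (simp add: V_sum_left V_sum_right sum_closed) (rule sum.swap)
      then show "(\<Sum>j\<in>?J r. \<Sum>k\<in>?J s. step3 r s * B j k) = step3 r s * V (S r x) (S s y)"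
        by (simp add: sum_distrib_left)
    qed
    finally show "(\<Sum>j\<in>?J r. \<Sum>s<3. \<Sum>k\<in>?J s. step3 r s * B j k)
        = (\<Sum>s<3. step3 r s * V (S r x) (S s y))" .
  qed
  finally have eq: "real n * (V (act m x) y - V x (act m y))
      = (\<Sum>r<3. \<Sum>s<3. step3 r s * V (S r x) (S s y))" .
  have each: "\<bar>step3 r s * V (S r x) (S s y)\<bar> \<le> C * norm x * norm y" for r s
  proof -
    have "\<bar>V (S r x) (S s y)\<bar> \<le> C * norm (S r x) * norm (S s y)" using bound S xy by blast
    also have "\<dots> \<le> C * norm x * norm y" using norm_S xy C by (intro mult_mono) auto
    finally have "\<bar>V (S r x) (S s y)\<bar> \<le> C * norm x * norm y" .
    moreover have "\<bar>step3 r s\<bar> \<le> 1" by (simp add: step3_def)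
    ultimately show ?thesis
      using mult_mono[of "\<bar>step3 r s\<bar>" 1 "\<bar>V (S r x) (S s y)\<bar>"] by (simp add: abs_mult)
  qed
  have "\<bar>\<Sum>r<3. \<Sum>s<3. step3 r s * V (S r x) (S s y)\<bar> \<le> (\<Sum>r<3::nat. \<Sum>s<3::nat. C * norm x * norm y)"
    by (intro order_trans[OF sum_abs] sum_mono each)
  then show ?thesis by (simp add: eq[symmetric] abs_mult)
qed

lemma balanced:
  assumes m: "multiplier m" and xy: "x \<in> A" "y \<in> A"
  shows "V (act m x) y = V x (act m y)"
proof -
  have unit: "V (act n x) y = V x (act n y)"
    if n: "multiplier n" "\<And>f. f \<in> X \<Longrightarrow> 0 \<le> n f" "\<And>f. f \<in> X \<Longrightarrow> n f \<le> 1" for n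
  proof (rule ccontr)
    assume "V (act n x) y \<noteq> V x (act n y)"
    then have "0 < \<bar>V (act n x) y - V x (act n y)\<bar>" by simp
    then obtain k where "9 * (C * norm x * norm y) < real k * \<bar>V (act n x) y - V x (act n y)\<bar>"
      using reals_Archimedean3 by blast
    with balanced_aux[OF n xy, of k] show False by simp
  qed
  obtain K where K: "K > 0" "\<And>f. f \<in> X \<Longrightarrow> \<bar>m f\<bar> \<le> K" using multiplier_bounded[OF m] by blast
  \<comment> \<open>An affine change of scale moves the values of \<open>m\<close> into [0, 1];
    bilinearity carries the identity back to \<open>m\<close>.\<close>
  define n where "n f = (1 / (2 * K)) * (m f + K)" for f
  have n: "multiplier n" unfolding n_def by (intro multiplier_scale multiplier_add m multiplier_const)
  have "0 \<le> n f" "n f \<le> 1" if "f \<in> X" for f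
    using K(1) K(2)[OF that] by (auto simp: n_def field_simps abs_le_iff)
  then have bal: "V (act n x) y = V x (act n y)" by (rule unit[OF n])
  have m_eq: "m f = 2 * K * n f - K" for f using K(1) by (simp add: n_def field_simps)
  have act_m: "act m z = (2 * K) *\<^sub>R act n z - K *\<^sub>R z" if "z \<in> A" for z
    by (rule act_eqI[OF m that])
      (use n that in \<open>simp_all add: ev closed act m_eq left_diff_distrib\<close>)
  have "V x (act m y) = 2 * K * V x (act n y) - K * V x y"
    using V_add_right[of x "(2 * K) *\<^sub>R act n y" "(- K) *\<^sub>R y"] xy act_closed[OF n]
      V_scale_right[of x y "-K"] closed(5)[of y "-K"]
    by (simp add: act_m V_scale_right closed)
  moreover have "V (act m x) y = 2 * K * V (act n x) y - K * V x y"
    using xy act_closed[OF n] by (simp add: act_m V_diff_left V_scale_left closed)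
  ultimately show ?thesis using bal by simp
qed

end

section \<open>Representing functionals\<close>

text \<open>Banach-Alaoglu through Tychonoff: functionals bounded by \<open>K\<close> are points of
  a product of compact intervals, linearity is a closed condition, and each equation is an
  intersection of closed conditions with tolerance 1/(n+1). The finite intersection property holds
  because \<open>K\<close> is the same for all finite sets.\<close>

lemma bounded_functional_compactness:
  fixes A :: "'a::real_normed_vector set" and z :: "'i \<Rightarrow> 'a" and c :: "'i \<Rightarrow> real"
  assumes approx: "\<And>F e. finite F \<Longrightarrow> F \<subseteq> I \<Longrightarrow> e > 0 \<Longrightarrow> \<exists>\<phi>. real_linear_on A \<phi> \<and>
      (\<forall>x\<in>A. \<bar>\<phi> x\<bar> \<le> K * norm x) \<and> (\<forall>i\<in>F. \<bar>\<phi> (z i) - c i\<bar> \<le> e)"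
    and "subspace A" and z: "\<And>i. i \<in> I \<Longrightarrow> z i \<in> A"
  obtains \<phi> where "real_linear_on A \<phi>" "\<And>x. x \<in> A \<Longrightarrow> \<bar>\<phi> x\<bar> \<le> K * norm x"
    "\<And>i. i \<in> I \<Longrightarrow> \<phi> (z i) = c i"
proof -
  \<comment> \<open>Functionals are total functions; pinning them to 0 outside \<open>A\<close>
    makes every factor of the product compact.\<close>
  define b where "b x = (if x \<in> A then K * norm x else 0)" for x
  define S where "S = (\<Pi>\<^sub>E x\<in>UNIV. {- b x..b x})"
  define L where "L = {\<phi>. real_linear_on A \<phi>}"
  define T where "T = (\<lambda>(i, n). {\<phi>. \<bar>\<phi> (z i) - c i\<bar> \<le> 1 / real (Suc n)})"
  have "compactin (product_topology (\<lambda>_. euclidean) UNIV) S"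
    unfolding S_def compactin_PiE by (simp add: compactin_euclidean_iff)
  then have "compact S" by (simp add: euclidean_product_topology compactin_euclidean_iff)
  have ev: "continuous_on UNIV (\<lambda>\<phi>. \<phi> x)" for x :: 'a
    by (rule continuous_on_product_coordinates)
  have "L = (\<Inter>x\<in>A. \<Inter>y\<in>A. {\<phi>. \<phi> (x + y) = \<phi> x + \<phi> y}) \<inter> (\<Inter>r. \<Inter>x\<in>A. {\<phi>. \<phi> (r *\<^sub>R x) = r * \<phi> x})"
    by (auto simp: L_def real_linear_on_def)
  moreover have "closed \<dots>"
    by (intro closed_Int closed_INT ballI closed_Collect_eq continuous_intros ev)
  ultimately have "closed L" by simp
  then have "compact (S \<inter> L)" using \<open>compact S\<close> by (rule compact_Int_closed[rotated])
  moreover have "closed U" if "U \<in> T ` (I \<times> UNIV)" for U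
    using that by (auto simp: T_def intro!: closed_Collect_le continuous_intros ev)
  moreover have "S \<inter> L \<inter> \<Inter>F \<noteq> {}" if F: "finite F" "F \<subseteq> T ` (I \<times> UNIV)" for F
  proof -
    obtain J where J: "J \<subseteq> I \<times> UNIV" "finite J" "F = T ` J" using finite_subset_image[OF F] by blast
    \<comment> \<open>One functional at the finest tolerance serves every condition in
      \<open>J\<close>; the inserted 0 covers an empty \<open>J\<close>.\<close>
    define N where "N = Max (insert 0 (snd ` J))"
    have N: "n \<le> N" if "(i, n) \<in> J" for i n
      unfolding N_def using that \<open>finite J\<close> by (intro Max_ge) force+
    obtain \<phi> where \<phi>: "real_linear_on A \<phi>" "\<And>x. x \<in> A \<Longrightarrow> \<bar>\<phi> x\<bar> \<le> K * norm x"
      "\<And>i. i \<in> fst ` J \<Longrightarrow> \<bar>\<phi> (z i) - c i\<bar> \<le> 1 / real (Suc N)"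
    proof -
      have "finite (fst ` J)" "fst ` J \<subseteq> I" "0 < 1 / real (Suc N)" using J by auto
      from approx[OF this] show ?thesis using that by blast
    qed
    define \<psi> where "\<psi> x = (if x \<in> A then \<phi> x else 0)" for x
    have "\<psi> \<in> S"
    proof -
      have "- b x \<le> \<psi> x \<and> \<psi> x \<le> b x" for x using \<phi>(2)[of x] by (auto simp: \<psi>_def b_def abs_le_iff)
      then show ?thesis by (simp add: S_def PiE_iff)
    qed
    moreover have "\<psi> \<in> L"
      using \<phi>(1) \<open>subspace A\<close>
      by (simp add: L_def \<psi>_def real_linear_on_def subspace_add subspace_scale)
    moreover have "\<psi> \<in> T (i, n)" if "(i, n) \<in> J" for i n
    proof -
      have "z i \<in> A" using that J z by blast
      moreover have "\<bar>\<phi> (z i) - c i\<bar> \<le> 1 / real (Suc N)" using that by (intro \<phi>(3)) force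
      moreover have "1 / real (Suc N) \<le> 1 / real (Suc n)" using N[OF that] by (simp add: frac_le)
      ultimately show ?thesis by (simp add: T_def \<psi>_def)
    qed
    ultimately show ?thesis using J(3) by auto
  qed
  ultimately have "S \<inter> L \<inter> \<Inter>(T ` (I \<times> UNIV)) \<noteq> {}" by (rule compact_imp_fip)
  then obtain \<phi> where \<phi>: "\<phi> \<in> S" "\<phi> \<in> L" "\<And>i n. i \<in> I \<Longrightarrow> \<phi> \<in> T (i, n)" by auto
  show thesis
  proof (rule that)
    show "\<bar>\<phi> x\<bar> \<le> K * norm x" if "x \<in> A" for x
    proof -
      have "\<phi> x \<in> {- b x..b x}" using \<phi>(1) unfolding S_def by blast
      then show ?thesis using that by (simp add: b_def abs_le_iff)
    qed
    show "\<phi> (z i) = c i" if "i \<in> I" for i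
    proof (rule ccontr)
      assume "\<phi> (z i) \<noteq> c i"
      then obtain n where "1 / real (Suc n) < \<bar>\<phi> (z i) - c i\<bar>"
        by (metis nat_approx_posE zero_less_abs_iff right_minus_eq)
      with \<phi>(3)[OF that, of n] show False by (simp add: T_def)
    qed
  qed (use \<phi> in \<open>simp add: L_def\<close>)
qed

section \<open>Moments of random sign sums\<close>

definition subset_sign :: "'i set \<Rightarrow> 'i \<Rightarrow> real" where
  "subset_sign D k = (if k \<in> D then 1 else - 1)"

lemma sum_Pow_insert:
  assumes "finite K" "k \<notin> K"
  shows "(\<Sum>D\<in>Pow (insert k K). h D) = (\<Sum>D\<in>Pow K. h D + h (insert k D))"
proof -
  have "inj_on (insert k) (Pow K)"
  proof (rule inj_onI)
    fix D E assume "D \<in> Pow K" "E \<in> Pow K" and eq: "insert k D = insert k E"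
    then have "k \<notin> D" "k \<notin> E" using assms(2) by auto
    then show "D = E" using eq by (simp add: insert_ident)
  qed
  moreover have "Pow K \<inter> insert k ` Pow K = {}" using assms(2) by blast
  ultimately show ?thesis
    using assms(1) by (simp add: Pow_insert sum.union_disjoint sum.reindex sum.distrib)
qed

lemma sum_sign_sum_insert:
  assumes "finite K" "k \<notin> K"
  shows "(\<Sum>D\<in>Pow (insert k K). h (\<Sum>j\<in>insert k K. subset_sign D j * a j))
    = (\<Sum>D\<in>Pow K. h ((\<Sum>j\<in>K. subset_sign D j * a j) - a k) + h ((\<Sum>j\<in>K. subset_sign D j * a j) + a k))"
  unfolding sum_Pow_insert[OF assms]
proof (rule sum.cong[OF refl])
  fix D assume "D \<in> Pow K"
  then have "k \<notin> D" using assms by blast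
  then have "(\<Sum>j\<in>insert k K. subset_sign D j * a j) = (\<Sum>j\<in>K. subset_sign D j * a j) - a k"
    using assms by (simp add: subset_sign_def)
  moreover have "(\<Sum>j\<in>K. subset_sign (insert k D) j * a j) = (\<Sum>j\<in>K. subset_sign D j * a j)"
    using assms by (intro sum.cong) (auto simp: subset_sign_def)
  then have "(\<Sum>j\<in>insert k K. subset_sign (insert k D) j * a j) = (\<Sum>j\<in>K. subset_sign D j * a j) + a k"
    using assms by (simp add: subset_sign_def)
  ultimately show "h (\<Sum>j\<in>insert k K. subset_sign D j * a j) + h (\<Sum>j\<in>insert k K. subset_sign (insert k D) j * a j)
      = h ((\<Sum>j\<in>K. subset_sign D j * a j) - a k) + h ((\<Sum>j\<in>K. subset_sign D j * a j) + a k)"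
    by (simp only:)
qed

text \<open>Sums over \<open>Pow K\<close> are expectations over independent signs, scaled by
  \<open>2 ^ card K\<close>. The cross terms cancel between the two signs of each new
  element.\<close>

lemma sign_sum_second_moment:
  assumes "finite K"
  shows "(\<Sum>D\<in>Pow K. (\<Sum>k\<in>K. subset_sign D k * a k)\<^sup>2) = 2 ^ card K * (\<Sum>k\<in>K. (a k)\<^sup>2)"
  using assms
proof (induction K)
  case (insert k K)
  have "(\<Sum>D\<in>Pow (insert k K). (\<Sum>j\<in>insert k K. subset_sign D j * a j)\<^sup>2)
      = (\<Sum>D\<in>Pow K. 2 * (\<Sum>j\<in>K. subset_sign D j * a j)\<^sup>2 + 2 * (a k)\<^sup>2)"
    using sum_sign_sum_insert[OF insert.hyps, of "\<lambda>x. x\<^sup>2" a]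
    by (simp only:) (intro sum.cong refl, simp add: power2_eq_square algebra_simps)
  then show ?case
    using insert by (simp add: sum.distrib card_Pow algebra_simps flip: sum_distrib_left)
qed simp

text \<open>Khinchin's inequality for the fourth moment, with its constant 3; odd powers of the new
  term cancel between its two signs.\<close>

lemma sign_sum_fourth_moment:
  assumes "finite K"
  shows "(\<Sum>D\<in>Pow K. (\<Sum>k\<in>K. subset_sign D k * a k) ^ 4) \<le> 3 * 2 ^ card K * (\<Sum>k\<in>K. (a k)\<^sup>2)\<^sup>2"
  using assms
proof (induction K)
  case (insert k K)
  let ?s = "\<Sum>j\<in>K. (a j)\<^sup>2"
  have "(\<Sum>D\<in>Pow (insert k K). (\<Sum>j\<in>insert k K. subset_sign D j * a j) ^ 4)
      = (\<Sum>D\<in>Pow K. 2 * (\<Sum>j\<in>K. subset_sign D j * a j) ^ 4 + 12 * (a k)\<^sup>2 * (\<Sum>j\<in>K. subset_sign D j * a j)\<^sup>2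
          + 2 * (a k) ^ 4)"
    using sum_sign_sum_insert[OF insert.hyps, of "\<lambda>x. x ^ 4" a]
    by (simp only:) (intro sum.cong refl, simp add: power2_eq_square power4_eq_xxxx algebra_simps)
  also have "\<dots> = 2 * (\<Sum>D\<in>Pow K. (\<Sum>j\<in>K. subset_sign D j * a j) ^ 4)
      + 12 * (a k)\<^sup>2 * (2 ^ card K * ?s) + 2 * (a k) ^ 4 * 2 ^ card K"
    using insert.hyps by (simp add: sum.distrib card_Pow sign_sum_second_moment flip: sum_distrib_left)
  \<comment> \<open>Raising the coefficient of the fourth power of \<open>a k\<close> from 2 to 6
    completes the square of \<open>?s + (a k)\<^sup>2\<close>.\<close>
  also have "\<dots> \<le> 2 * (3 * 2 ^ card K * ?s\<^sup>2) + 12 * (a k)\<^sup>2 * (2 ^ card K * ?s)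
      + 6 * (a k) ^ 4 * 2 ^ card K"
    using insert.IH by (intro add_mono mult_left_mono mult_right_mono) auto
  also have "\<dots> = 3 * 2 ^ card (insert k K) * (\<Sum>j\<in>insert k K. (a j)\<^sup>2)\<^sup>2"
    using insert.hyps by (simp add: power2_eq_square power4_eq_xxxx algebra_simps)
  finally show ?case .
qed simp

text \<open>The left-hand side is the parabola through 0 that touches the right-hand side at \<open>t = 2 \<sigma>\<close>.\<close>

lemma truncated_square_ge:
  fixes t \<sigma> :: real
  assumes "0 \<le> t" "0 < \<sigma>"
  shows "7 * t / \<sigma> - 2 * t\<^sup>2 / \<sigma>\<^sup>2 \<le> 27 * (\<sigma> * t / (\<sigma> + t)\<^sup>2)"
proof -
  define r where "r = t / \<sigma>"
  have r: "0 \<le> r" "t = r * \<sigma>" using assms by (auto simp: r_def)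
  have "27 * r - (7 * r - 2 * r\<^sup>2) * (1 + r)\<^sup>2 = r * ((r - 2)\<^sup>2 * (2 * r + 5))"
    by (simp add: power2_eq_square algebra_simps)
  also have "\<dots> \<ge> 0" using r by simp
  finally have "(7 * r - 2 * r\<^sup>2) * (1 + r)\<^sup>2 \<le> 27 * r" by simp
  then have "7 * r - 2 * r\<^sup>2 \<le> 27 * r / (1 + r)\<^sup>2" using r by (simp add: pos_le_divide_eq)
  also have "\<dots> = 27 * (\<sigma> * t / (\<sigma> + t)\<^sup>2)"
  proof -
    have "(\<sigma> + t)\<^sup>2 = \<sigma>\<^sup>2 * (1 + r)\<^sup>2" by (simp add: r(2) power2_eq_square algebra_simps)
    then show ?thesis using assms(2) by (simp add: r(2) power2_eq_square)
  qed
  finally show ?thesis using assms(2) by (simp add: r(2) power_mult_distrib)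
qed

text \<open>An argument in the style of Paley and Zygmund: the squared sign sum has mean s and
  second moment at most 3 s^2, so it cannot be small most of the time. The parabola is fitted to
  this: with \<rho> = s / (s + \<delta>) \<le> 1 its mean is at least 7 \<rho> - 6 \<rho>^2, which
  is at least \<rho>.\<close>

lemma truncated_sign_sum_average_ge:
  fixes a :: "'i \<Rightarrow> real"
  assumes K: "finite K" and "\<delta> > 0"
  defines "s \<equiv> \<Sum>k\<in>K. (a k)\<^sup>2" and "g \<equiv> \<lambda>D. \<Sum>k\<in>K. subset_sign D k * a k"
  shows "2 ^ card K * (s / (s + \<delta>))
    \<le> 27 * (\<Sum>D\<in>Pow K. (s + \<delta>) * (g D)\<^sup>2 / (s + \<delta> + (g D)\<^sup>2)\<^sup>2)"
proof -
  let ?\<sigma> = "s + \<delta>"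
  let ?N = "2 ^ card K :: real"
  have "0 \<le> s" unfolding s_def by (intro sum_nonneg) simp
  then have \<sigma>: "0 < ?\<sigma>" "s / ?\<sigma> \<le> 1" "0 \<le> s / ?\<sigma>" using \<open>\<delta> > 0\<close> by auto
  have fourth: "((g D)\<^sup>2)\<^sup>2 = g D ^ 4" for D by (simp flip: power_mult)
  have "?N * (s / ?\<sigma>) \<le> ?N * (7 * (s / ?\<sigma>) - 6 * (s / ?\<sigma>)\<^sup>2)"
  proof (rule mult_left_mono)
    show "s / ?\<sigma> \<le> 7 * (s / ?\<sigma>) - 6 * (s / ?\<sigma>)\<^sup>2"
      using mult_left_le[OF \<sigma>(2,3)] unfolding power2_eq_square by linarith
  qed simp
  also have "\<dots> = 7 * (?N * s) / ?\<sigma> - 2 * (3 * ?N * s\<^sup>2) / ?\<sigma>\<^sup>2"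
    by (simp add: power_divide algebra_simps)
  also have "\<dots> \<le> 7 * (\<Sum>D\<in>Pow K. (g D)\<^sup>2) / ?\<sigma> - 2 * (\<Sum>D\<in>Pow K. g D ^ 4) / ?\<sigma>\<^sup>2"
    unfolding g_def s_def sign_sum_second_moment[OF K]
    by (intro diff_left_mono divide_right_mono mult_left_mono sign_sum_fourth_moment[OF K]) auto
  also have "\<dots> = (\<Sum>D\<in>Pow K. 7 * (g D)\<^sup>2 / ?\<sigma> - 2 * ((g D)\<^sup>2)\<^sup>2 / ?\<sigma>\<^sup>2)"
    by (simp add: fourth sum_subtractf sum_distrib_left sum_divide_distrib)
  also have "\<dots> \<le> (\<Sum>D\<in>Pow K. 27 * (?\<sigma> * (g D)\<^sup>2 / (?\<sigma> + (g D)\<^sup>2)\<^sup>2))"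
    by (intro sum_mono truncated_square_ge \<sigma>) simp
  finally show ?thesis by (simp add: sum_distrib_left)
qed

text \<open>The factor is close to 1 only where s, and with it t, is small; where t is large the
  factor is small. With r = sqrt \<delta> everything rests on r t \<le> t^2 + r^2.\<close>

lemma damping_le:
  fixes t s \<delta> :: real
  assumes "0 \<le> t" "t\<^sup>2 \<le> s" "0 < \<delta>"
  shows "\<delta> / (s + \<delta>) * t \<le> sqrt \<delta>"
proof -
  define r where "r = sqrt \<delta>"
  have r: "0 < r" "\<delta> = r\<^sup>2" using assms by (auto simp: r_def)
  have "r * t \<le> t\<^sup>2 + r\<^sup>2"
    using sum_squares_bound[of r t] mult_nonneg_nonneg[of r t] r assms(1) by linarith
  also have "\<dots> \<le> s + r\<^sup>2" using assms by simp
  finally have "r * (r * t) \<le> r * (s + r\<^sup>2)" using r by simp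
  moreover have "0 < s + r\<^sup>2" using r assms by (smt (verit) zero_le_power2 zero_less_power)
  ultimately have "\<delta> / (s + \<delta>) * t \<le> r" by (simp add: r(2) pos_divide_le_eq power2_eq_square mult.assoc)
  then show ?thesis by (simp add: r_def)
qed

section \<open>Damping near common zeros, and self-adjoint arguments\<close>

context comm_real_cstar
begin

text \<open>For finite \<open>K\<close> its zeros are the common zeros of \<open>K\<close>, so
  \<open>sqsum K f / (sqsum K f + \<delta>)\<close> acts as an approximate unit on the members of
  \<open>K\<close> as \<delta> tends to 0.\<close>

definition sqsum :: "'a set \<Rightarrow> ('a \<Rightarrow> complex) \<Rightarrow> real" where
  "sqsum K f = (\<Sum>k\<in>K. (cmod (f k))\<^sup>2)"

lemma sqsum_nonneg: "0 \<le> sqsum K f"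
  unfolding sqsum_def by (intro sum_nonneg) simp

lemma sqsum_ge: "finite K \<Longrightarrow> k \<in> K \<Longrightarrow> (cmod (f k))\<^sup>2 \<le> sqsum K f"
  unfolding sqsum_def by (rule member_le_sum) auto

lemma ev_star_mult_self: "f \<in> X \<Longrightarrow> k \<in> A \<Longrightarrow> f (k\<^sup>\<star> * k) = of_real ((cmod (f k))\<^sup>2)"
  using complex_norm_square[of "f k"] by (simp add: ev closed mult.commute)

lemma multiplier_sqsum:
  assumes "K \<subseteq> A"
  shows "multiplier (sqsum K)"
proof -
  have "multiplier (\<lambda>f. (cmod (f k))\<^sup>2)" if "k \<in> K" for k
  proof (rule multiplier_cong)
    have k: "k \<in> A" using that assms by blast
    show "multiplier (\<lambda>f. Re (f (k\<^sup>\<star> * k)))"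
      by (rule multiplier_Re) (use k in \<open>auto simp: closed star_mult star_star\<close>)
    show "Re (f (k\<^sup>\<star> * k)) = (cmod (f k))\<^sup>2" if "f \<in> X" for f
      using ev_star_mult_self[OF that k] by simp
  qed
  then show ?thesis unfolding sqsum_def by (rule multiplier_sum)
qed

lemma norm_damping_le:
  assumes "finite K" "k \<in> K" "k \<in> A" "\<delta> > 0" "multiplier m"
    and m: "\<And>f. f \<in> X \<Longrightarrow> \<bar>1 - m f\<bar> \<le> \<delta> / (sqsum K f + \<delta>)"
  shows "norm (k - act m k) \<le> sqrt \<delta>"
proof (rule norm_leI)
  fix f assume f: "f \<in> X"
  have "f (k - act m k) = of_real (1 - m f) * f k"
    using assms f by (simp add: ev act left_diff_distrib)
  then have "cmod (f (k - act m k)) \<le> \<delta> / (sqsum K f + \<delta>) * cmod (f k)"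
    using m[OF f] by (simp only: norm_mult norm_of_real) (intro mult_right_mono; simp)
  also have "\<dots> \<le> sqrt \<delta>"
    using damping_le[OF _ sqsum_ge[OF assms(1,2)] \<open>\<delta> > 0\<close>] by simp
  finally show "cmod (f (k - act m k)) \<le> sqrt \<delta>" .
qed (use assms in \<open>auto simp: act closed\<close>)

lemma act_Re:
  assumes "h \<in> A" "h\<^sup>\<star> = h" "y \<in> A"
  shows "act (\<lambda>f. Re (f h)) y = h * y"
proof (rule act_eqI)
  show "f (h * y) = of_real (Re (f h)) * f y" if "f \<in> X" for f
    using multiplier_Re(2)[OF assms(1,2) that] ev_mult[OF that assms(1,3)] by simp
qed (use assms multiplier_Re closed in auto)

end

context orthogonal_form
begin

lemma V_damping_le:
  assumes "finite K" "k \<in> K" "k \<in> A" "y \<in> A" "\<delta> > 0" "multiplier m"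
    and "\<And>f. f \<in> X \<Longrightarrow> \<bar>1 - m f\<bar> \<le> \<delta> / (sqsum K f + \<delta>)"
  shows "\<bar>V (act m k) y - V k y\<bar> \<le> C * sqrt \<delta> * norm y"
proof -
  have mk: "act m k \<in> A" using assms by (simp add: act)
  have "\<bar>V (act m k) y - V k y\<bar> = \<bar>V (k - act m k) y\<bar>"
    using V_diff_left[OF assms(3) mk assms(4)] by simp
  also have "\<dots> \<le> C * norm (k - act m k) * norm y" using assms mk by (intro bound closed)
  also have "\<dots> \<le> C * sqrt \<delta> * norm y"
    using C norm_damping_le[OF assms(1,2,3,5,6,7)] by (intro mult_right_mono mult_left_mono) auto
  finally show ?thesis .
qed

lemma small_damping:
  assumes "finite Y" "e > 0"
  obtains \<delta> where "\<delta> > 0" "\<And>y. y \<in> Y \<Longrightarrow> C * sqrt \<delta> * norm y \<le> e"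
proof -
  define M where "M = (\<Sum>y\<in>Y. norm y)"
  have "0 \<le> M" unfolding M_def by (intro sum_nonneg) simp
  have M: "norm y \<le> M" if "y \<in> Y" for y unfolding M_def using assms that by (intro member_le_sum) auto
  define r where "r = e / (C * M + 1)"
  have "0 < C * M + 1" using C \<open>0 \<le> M\<close> by (simp add: add_nonneg_pos)
  then have r: "r > 0" "r * (C * M) \<le> e" using assms(2) C \<open>0 \<le> M\<close> by (auto simp: r_def field_simps)
  show thesis
  proof (rule that[of "r\<^sup>2"])
    show "C * sqrt (r\<^sup>2) * norm y \<le> e" if "y \<in> Y" for y
    proof -
      have "C * sqrt (r\<^sup>2) * norm y \<le> C * r * M"
        using r C M[OF that] by (intro mult_mono) auto
      then show ?thesis using r by (simp add: mult.commute mult.left_commute)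
    qed
  qed (use r in simp)
qed

text \<open>The functional is \<open>V u\<close> for an approximate unit \<open>u\<close> in
  \<open>A\<close> built from the first components; \<open>norm u \<le> 1\<close> makes the bound
  independent of \<open>F\<close>.\<close>

lemma self_adjoint_functional_approx:
  assumes F: "finite F" "\<And>h y. (h, y) \<in> F \<Longrightarrow> h \<in> A \<and> h\<^sup>\<star> = h \<and> y \<in> A" and "e > 0"
  shows "\<exists>\<phi>. real_linear_on A \<phi> \<and> (\<forall>x\<in>A. \<bar>\<phi> x\<bar> \<le> C * norm x) \<and>
    (\<forall>(h, y)\<in>F. \<bar>\<phi> (h * y) - V h y\<bar> \<le> e)"
proof -
  obtain \<delta> where \<delta>: "\<delta> > 0" "\<And>y. y \<in> snd ` F \<Longrightarrow> C * sqrt \<delta> * norm y \<le> e"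
    using small_damping[OF finite_imageI[OF F(1), of snd] \<open>e > 0\<close>] by blast
  let ?K = "fst ` F"
  have K: "finite ?K" "?K \<subseteq> A" using F by auto
  define s where "s = (\<Sum>h\<in>?K. h\<^sup>\<star> * h)"
  have s: "s \<in> A" unfolding s_def using K by (intro sum_closed) (auto simp: closed)
  have ev_s: "f s = of_real (sqsum ?K f)" if "f \<in> X" for f
  proof -
    have "f s = (\<Sum>h\<in>?K. f (h\<^sup>\<star> * h))" unfolding s_def
      using K by (intro ev_sum[OF that]) (auto simp: closed)
    also have "\<dots> = (\<Sum>h\<in>?K. of_real ((cmod (f h))\<^sup>2))"
      using K ev_star_mult_self[OF that] by (intro sum.cong) auto
    finally show ?thesis by (simp add: sqsum_def)
  qed
  have den: "\<delta> \<le> sqsum ?K f + \<delta>" for f using sqsum_nonneg by simp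
  have md: "multiplier (\<lambda>f. sqsum ?K f + \<delta>)" by (intro multiplier_add multiplier_sqsum multiplier_const K)
  define \<theta> where "\<theta> f = sqsum ?K f / (sqsum ?K f + \<delta>)" for f
  have \<theta>: "multiplier \<theta>" unfolding \<theta>_def
    by (rule multiplier_divide[OF multiplier_sqsum[OF K(2)] md \<delta>(1) den])
  have inv: "multiplier (\<lambda>f. 1 / (sqsum ?K f + \<delta>))"
    by (rule multiplier_divide[OF multiplier_const md \<delta>(1) den])
  \<comment> \<open>The reciprocal need not come from an element of \<open>A\<close>, but as a
    multiplier it acts on \<open>s\<close>, which is how \<open>u\<close> lands in
    \<open>A\<close>.\<close>
  define u where "u = act (\<lambda>f. 1 / (sqsum ?K f + \<delta>)) s"
  have u: "u \<in> A" using act_closed[OF inv s] by (simp add: u_def)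
  have ev_u: "f u = of_real (\<theta> f)" if "f \<in> X" for f
    using that by (simp add: u_def ev_act[OF inv s] ev_s \<theta>_def)
  have \<theta>_range: "0 \<le> \<theta> f" "\<theta> f \<le> 1" for f
    using \<delta>(1) sqsum_nonneg[of ?K f] by (auto simp: \<theta>_def)
  have "norm u \<le> 1" by (rule norm_leI[OF u]) (use \<theta>_range in \<open>simp_all add: ev_u\<close>)
  have "real_linear_on A (V u)" using orth u by (simp add: orthogonal_form_on_def bilinear_form_on_def)
  moreover have "\<bar>V u x\<bar> \<le> C * norm x" if "x \<in> A" for x
  proof -
    have "C * norm u * norm x \<le> C * 1 * norm x"
      using C \<open>norm u \<le> 1\<close> by (intro mult_right_mono mult_left_mono) auto
    then show ?thesis using bound[OF u that] by simp
  qed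
  moreover have "\<bar>V u (h * y) - V h y\<bar> \<le> e" if "(h, y) \<in> F" for h y
  proof -
    have hy: "h \<in> A" "h\<^sup>\<star> = h" "y \<in> A" "h \<in> ?K" "y \<in> snd ` F" using F(2)[OF that] that by force+
    \<comment> \<open>The damped \<open>h\<close> is also the result of letting \<open>h\<close> act
      on \<open>u\<close>, and that action can be moved across to \<open>y\<close>.\<close>
    have "act \<theta> h = h * u"
      by (rule act_eqI[OF \<theta>]) (use hy u in \<open>auto simp: closed ev ev_u mult.commute\<close>)
    also have "\<dots> = act (\<lambda>f. Re (f h)) u" using act_Re hy u by simp
    finally have "V (act \<theta> h) y = V u (h * y)"
      using balanced[OF multiplier_Re(1)[OF hy(1,2)] u hy(3)] act_Re[OF hy(1-3)] by simp
    moreover have "\<bar>1 - \<theta> f\<bar> \<le> \<delta> / (sqsum ?K f + \<delta>)" for f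
      using \<delta>(1) sqsum_nonneg[of ?K f] by (simp add: \<theta>_def field_simps)
    then have "\<bar>V (act \<theta> h) y - V h y\<bar> \<le> C * sqrt \<delta> * norm y"
      by (rule V_damping_le[OF K(1) hy(4,1,3) \<delta>(1) \<theta>])
    ultimately show ?thesis using \<delta>(2)[OF hy(5)] by simp
  qed
  ultimately show ?thesis by blast
qed

end

section \<open>Two skew arguments\<close>

context orthogonal_form
begin

text \<open>
  The skew elements are the sections of a real line bundle that may be nontrivial, so no single skew
  element is bounded away from zero. The truncated random sign sums of finitely many skew
  elements replace such an element: their squares are, on average, bounded below.
\<close>

lemma skew_functional_approx:
  assumes K: "finite K" "K \<subseteq> A" and skew: "\<And>k. k \<in> K \<Longrightarrow> k\<^sup>\<star> = - k" and \<delta>: "\<delta> > 0"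
  shows "\<exists>\<phi>. real_linear_on A \<phi> \<and> (\<forall>x\<in>A. \<bar>\<phi> x\<bar> \<le> 27 * C * norm x) \<and>
    (\<forall>k\<in>K. \<forall>k'\<in>K. \<bar>\<phi> (k * k') - V k k'\<bar> \<le> C * sqrt \<delta> * norm k')"
proof -
  define N where "N = (2 :: real) ^ card K"
  have N: "N > 0" "real (card (Pow K)) = N" using K(1) by (simp_all add: N_def card_Pow)
  have KA: "k \<in> A" if "k \<in> K" for k using K(2) that by blast
  define G where "G D = (\<Sum>k\<in>K. subset_sign D k *\<^sub>R k)" for D
  have G: "G D \<in> A" for D unfolding G_def by (intro sum_closed closed KA)
  have ev_k: "f k = \<i> * of_real (Im (f k))" if "f \<in> X" "k \<in> K" for f k
    using ev_star[OF that(1) KA[OF that(2)]] skew[OF that(2)] ev_uminus[OF that(1) KA[OF that(2)]]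
    by (simp add: complex_eq_iff)
  define g where "g D f = (\<Sum>k\<in>K. subset_sign D k * Im (f k))" for D and f :: "'a \<Rightarrow> complex"
  have ev_G: "f (G D) = \<i> * of_real (g D f)" if f: "f \<in> X" for f D
  proof -
    have "f (G D) = (\<Sum>k\<in>K. f (subset_sign D k *\<^sub>R k))"
      unfolding G_def using KA by (intro ev_sum[OF f]) (simp add: closed)
    also have "\<dots> = (\<Sum>k\<in>K. \<i> * of_real (subset_sign D k * Im (f k)))"
    proof (rule sum.cong[OF refl])
      fix k assume k: "k \<in> K"
      have "f (subset_sign D k *\<^sub>R k) = of_real (subset_sign D k) * (\<i> * of_real (Im (f k)))"
        using ev_scaleR[OF f KA[OF k]] ev_k[OF f k] by metis
      then show "f (subset_sign D k *\<^sub>R k) = \<i> * of_real (subset_sign D k * Im (f k))" by simp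
    qed
    finally show ?thesis by (simp only: g_def of_real_sum sum_distrib_left)
  qed
  have sq: "sqsum K f = (\<Sum>k\<in>K. (Im (f k))\<^sup>2)" if f: "f \<in> X" for f
    unfolding sqsum_def
  proof (rule sum.cong[OF refl])
    fix k assume "k \<in> K"
    from ev_k[OF f this] have "Re (f k) = 0" by (simp add: complex_eq_iff)
    then show "(cmod (f k))\<^sup>2 = (Im (f k))\<^sup>2" by (simp add: cmod_power2)
  qed
  have gsq: "sqsum {G D} f = (g D f)\<^sup>2" if "f \<in> X" for f D
    using ev_G[OF that] by (simp add: sqsum_def norm_mult)

  define \<sigma> where "\<sigma> f = sqsum K f + \<delta>" for f
  have \<sigma>: "\<delta> \<le> \<sigma> f" "0 < \<sigma> f" for f using sqsum_nonneg[of K f] \<delta> by (simp_all add: \<sigma>_def)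
  have m\<sigma>: "multiplier \<sigma>" unfolding \<sigma>_def by (intro multiplier_add multiplier_sqsum multiplier_const K)
  have mp: "multiplier (sqsum {G D})" for D by (rule multiplier_sqsum) (use G in simp)
  \<comment> \<open>The truncation: \<open>w D f * g D f\<close> has square \<sigma> g^2 / (\<sigma>
    + g^2)^2, which is at most 1 whatever the size of \<open>K\<close> and whose average over the
    signs is bounded below.\<close>
  define w where "w D f = sqrt (\<sigma> f) / (\<sigma> f + sqsum {G D} f)" for D f
  have mw: "multiplier (w D)" for D
    unfolding w_def
    by (rule multiplier_divide[OF multiplier_continuous[OF m\<sigma>] multiplier_add[OF m\<sigma> mp] \<delta>])
      (use \<sigma> sqsum_nonneg in \<open>auto intro!: continuous_intros add_increasing2\<close>)
  define r where "r D f = w D f * w D f * sqsum {G D} f" for D f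
  have mr: "multiplier (r D)" for D unfolding r_def by (intro multiplier_mult mw mp)
  have r_eq: "r D f = \<sigma> f * sqsum {G D} f / (\<sigma> f + sqsum {G D} f)\<^sup>2" for D f
    using \<sigma>(2)[of f] by (simp add: r_def w_def power2_eq_square)
  have r_nonneg: "0 \<le> r D f" for D f unfolding r_eq using \<sigma>(2)[of f] sqsum_nonneg by simp
  have r_le: "r D f \<le> 1" for D f
  proof -
    have "\<sigma> f * sqsum {G D} f \<le> (\<sigma> f + sqsum {G D} f)\<^sup>2"
      using \<sigma>(2)[of f] sqsum_nonneg[of "{G D}" f] by (simp add: power2_sum)
    then show ?thesis unfolding r_eq using \<sigma>(2)[of f] sqsum_nonneg[of "{G D}" f]
      by (simp add: divide_le_eq)
  qed
  define q where "q f = (1 / N) * (\<Sum>D\<in>Pow K. r D f)" for f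
  have mq: "multiplier q" unfolding q_def by (intro multiplier_scale multiplier_sum mr)
  have q_nonneg: "0 \<le> q f" for f
    unfolding q_def using N(1) by (intro mult_nonneg_nonneg sum_nonneg r_nonneg) simp
  have q_ge: "sqsum K f / \<sigma> f \<le> 27 * q f" if f: "f \<in> X" for f
  proof -
    have "N * (sqsum K f / \<sigma> f) \<le> 27 * (\<Sum>D\<in>Pow K. r D f)"
      using truncated_sign_sum_average_ge[OF K(1) \<delta>, of "\<lambda>k. Im (f k)"]
      by (simp add: N_def r_eq \<sigma>_def sq[OF f] gsq[OF f] g_def)
    then show ?thesis using N(1) by (simp add: q_def field_simps)
  qed
  \<comment> \<open>The lower bound \<open>sqsum K f / \<sigma> f\<close> for
    \<open>27 * q f\<close> degenerates near common zeros of \<open>K\<close>. Adding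
    \<open>\<delta> / \<sigma> f\<close> lifts it to 1, and the error so introduced is a damping
    factor that \<open>V_damping_le\<close> can absorb.\<close>
  define d where "d f = 27 * q f + \<delta> / \<sigma> f" for f
  have d_ge: "1 \<le> d f" if "f \<in> X" for f
  proof -
    have "1 = sqsum K f / \<sigma> f + \<delta> / \<sigma> f"
      using \<sigma>(2)[of f] by (simp add: \<sigma>_def flip: add_divide_distrib)
    then show ?thesis using q_ge[OF that] by (simp add: d_def)
  qed
  have md: "multiplier d" unfolding d_def
    by (intro multiplier_add multiplier_scale mq multiplier_divide[OF multiplier_const m\<sigma> \<delta> \<sigma>(1)])
  define m where "m f = 27 / d f" for f
  have mm: "multiplier m" unfolding m_def
    by (rule multiplier_divide[OF multiplier_const md zero_less_one d_ge])
  have m_range: "0 \<le> m f" "m f \<le> 27" if "f \<in> X" for f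
    using d_ge[OF that] by (simp_all add: m_def divide_le_eq)
  \<comment> \<open>The sign compensates for squaring a skew element: the square of
    \<open>a D\<close> takes the values \<open>- r D f\<close>.\<close>
  define n where "n f = - 1 * m f" for f
  have mn: "multiplier n" unfolding n_def by (rule multiplier_scale[OF mm])

  define a where "a D = act (w D) (G D)" for D
  have a: "a D \<in> A" for D using act_closed[OF mw G] by (simp add: a_def)
  have ev_a: "f (a D) = \<i> * of_real (w D f * g D f)" if "f \<in> X" for f D
    using ev_act[OF mw G that] ev_G[OF that] by (simp add: a_def)
  have norm_a: "norm (a D) \<le> 1" for D
  proof (rule norm_leI[OF a])
    fix f assume f: "f \<in> X"
    have "cmod (f (a D)) = \<bar>w D f * g D f\<bar>" by (simp add: ev_a[OF f] norm_mult abs_mult)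
    then have "(cmod (f (a D)))\<^sup>2 = (w D f * g D f)\<^sup>2" by simp
    also have "\<dots> = r D f" by (simp add: r_def gsq[OF f] power2_eq_square)
    finally have "(cmod (f (a D)))\<^sup>2 = r D f" .
    then show "cmod (f (a D)) \<le> 1" using r_le[of D f] by (simp add: power2_le_imp_le)
  qed simp

  \<comment> \<open>At k k' each summand becomes V (m r k) k', so the average is V ((m q) k) k', and
    m q differs from 1 by at most \<delta> / \<sigma>. The bound 27 C comes from
    \<open>m f \<le> 27\<close> and \<open>norm (a D) \<le> 1\<close>.\<close>
  define \<phi> where "\<phi> z = (1 / N) * (\<Sum>D\<in>Pow K. V (a D) (act n (z * a D)))" for z
  have za: "z * a D \<in> A" "act n (z * a D) \<in> A" if "z \<in> A" for z D
    using that a act_closed[OF mn] by (simp_all add: closed)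
  have "real_linear_on A \<phi>"
  proof -
    have "V (a D) (act n ((x + y) * a D)) = V (a D) (act n (x * a D)) + V (a D) (act n (y * a D))"
      if xy: "x \<in> A" "y \<in> A" for x y D
    proof -
      have "act n ((x + y) * a D) = act n (x * a D) + act n (y * a D)"
        by (rule act_eqI[OF mn]) (use xy a za in \<open>simp_all add: closed ev ev_act[OF mn] algebra_simps\<close>)
      then show ?thesis using a za xy by (simp add: V_add_right)
    qed
    moreover have "V (a D) (act n ((c *\<^sub>R x) * a D)) = c * V (a D) (act n (x * a D))"
      if x: "x \<in> A" for c x D
    proof -
      have "act n ((c *\<^sub>R x) * a D) = c *\<^sub>R act n (x * a D)"
        by (rule act_eqI[OF mn]) (use x a za in \<open>simp_all add: closed ev ev_act[OF mn]\<close>)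
      then show ?thesis using a za x by (simp add: V_scale_right)
    qed
    ultimately show ?thesis
      unfolding real_linear_on_def \<phi>_def by (simp add: sum.distrib sum_distrib_left sum_divide_distrib add_divide_distrib)
  qed
  moreover have "\<bar>\<phi> z\<bar> \<le> 27 * C * norm z" if z: "z \<in> A" for z
  proof -
    have "\<bar>V (a D) (act n (z * a D))\<bar> \<le> 27 * C * norm z" for D
    proof -
      have "norm (act n (z * a D)) \<le> 27 * norm (z * a D)"
        by (rule norm_act_le[OF mn za(1)[OF z]]) (use m_range in \<open>simp_all add: n_def\<close>)
      also have "norm (z * a D) \<le> norm z * 1"
        by (intro order_trans[OF norm_mult_ineq] mult_left_mono norm_a) simp
      finally have "norm (act n (z * a D)) \<le> 27 * norm z" by simp
      then have "C * norm (a D) * norm (act n (z * a D)) \<le> C * 1 * (27 * norm z)"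
        using C norm_a by (intro mult_mono) auto
      moreover have "\<bar>V (a D) (act n (z * a D))\<bar> \<le> C * norm (a D) * norm (act n (z * a D))"
        by (rule bound[OF a za(2)[OF z]])
      ultimately show ?thesis by simp
    qed
    then have "\<bar>\<Sum>D\<in>Pow K. V (a D) (act n (z * a D))\<bar> \<le> real (card (Pow K)) * (27 * C * norm z)"
      by (intro order_trans[OF sum_abs] sum_bounded_above)
    then show ?thesis using N by (simp add: \<phi>_def abs_mult divide_le_eq mult.commute)
  qed
  moreover have "\<bar>\<phi> (k * k') - V k k'\<bar> \<le> C * sqrt \<delta> * norm k'" if k: "k \<in> K" "k' \<in> K" for k k'
  proof -
    note kA = KA[OF k(1)] KA[OF k(2)]
    have each: "V (a D) (act n (k * k' * a D)) = V (act (\<lambda>f. m f * r D f) k) k'" for D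
    proof -
      \<comment> \<open>A product of two commuting skew elements is self-adjoint, so
        \<open>h\<close> acts as a real multiplier and can be moved to the first argument.\<close>
      define h where "h = k * a D"
      have h: "h \<in> A" using kA a by (simp add: h_def closed)
      have ev_h: "f h = of_real (- (Im (f k) * w D f * g D f))" if "f \<in> X" for f
      proof -
        have "f h = f k * f (a D)" using kA a that by (simp add: h_def ev)
        then show ?thesis by (subst (asm) ev_k[OF that k(1)]) (simp add: ev_a[OF that] complex_eq_iff)
      qed
      have hs: "h\<^sup>\<star> = h"
        by (rule eqI) (use h in \<open>simp_all add: closed ev_star ev_h\<close>)
      note mh = multiplier_Re(1)[OF h hs]
      have "k * k' * a D = h * k'"
        using commute[OF kA(2) a] by (simp add: h_def mult.assoc)
      then have "V (a D) (act n (k * k' * a D)) = V (a D) (act n (act (\<lambda>f. Re (f h)) k'))"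
        using act_Re[OF h hs kA(2)] by simp
      also have "\<dots> = V (act (\<lambda>f. Re (f h)) (act n (a D))) k'"
        using balanced[OF mn a act_closed[OF mh kA(2)]] balanced[OF mh act_closed[OF mn a] kA(2)]
        by simp
      also have "act (\<lambda>f. Re (f h)) (act n (a D)) = act (\<lambda>f. m f * r D f) k"
      proof (rule eqI)
        fix f assume f: "f \<in> X"
        have "f (act (\<lambda>f. m f * r D f) k) = of_real (m f * r D f) * (\<i> * of_real (Im (f k)))"
          using ev_act[OF multiplier_mult[OF mm mr] kA(1) f] ev_k[OF f k(1)] by metis
        then show "f (act (\<lambda>f. Re (f h)) (act n (a D))) = f (act (\<lambda>f. m f * r D f) k)"
          using f a by (simp add: ev_act[OF mh] ev_act[OF mn] act_closed[OF mn] ev_h ev_a n_def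
              r_def gsq power2_eq_square)
      qed (use act_closed mh mn a kA multiplier_mult[OF mm mr] in auto)
      finally show ?thesis .
    qed
    define \<mu> where "\<mu> f = (1 / N) * (\<Sum>D\<in>Pow K. m f * r D f)" for f
    have mmr: "multiplier (\<lambda>f. m f * r D f)" for D by (rule multiplier_mult[OF mm mr])
    have m\<mu>: "multiplier \<mu>" unfolding \<mu>_def by (intro multiplier_scale multiplier_sum mmr)
    have "act \<mu> k = (1 / N) *\<^sub>R (\<Sum>D\<in>Pow K. act (\<lambda>f. m f * r D f) k)"
      unfolding \<mu>_def by (subst act_scale) (simp_all add: act_sum mmr multiplier_sum kA)
    then have "V (act \<mu> k) k' = \<phi> (k * k')"
      unfolding \<phi>_def each using kA act_closed[OF mmr]
      by (simp only: V_scale_left V_sum_left sum_closed)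
    moreover have "\<bar>1 - \<mu> f\<bar> \<le> \<delta> / (sqsum K f + \<delta>)" if f: "f \<in> X" for f
    proof -
      have "\<mu> f = m f * q f" by (simp add: \<mu>_def q_def sum_distrib_left)
      then have "1 - \<mu> f = (\<delta> / \<sigma> f) / d f"
        using d_ge[OF f] by (simp add: m_def diff_divide_eq_iff) (simp add: d_def)
      moreover have *: "0 \<le> \<delta> / \<sigma> f" using \<sigma>(2)[of f] \<delta> by simp
      moreover have "(\<delta> / \<sigma> f) / d f \<le> (\<delta> / \<sigma> f) / 1" "0 \<le> (\<delta> / \<sigma> f) / d f"
        using divide_left_mono[OF d_ge[OF f] *] divide_nonneg_nonneg[OF *, of "d f"] d_ge[OF f]
        by simp_all
      ultimately show ?thesis unfolding \<sigma>_def by (metis abs_of_nonneg div_by_1)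
    qed
    ultimately show ?thesis
      using V_damping_le[OF K(1) k(1) kA \<delta> m\<mu>] by simp
  qed
  ultimately show ?thesis by blast
qed

section \<open>Exact representing functionals\<close>

lemma self_adjoint_functional:
  obtains \<phi> where "real_linear_on A \<phi>" "\<And>x. x \<in> A \<Longrightarrow> \<bar>\<phi> x\<bar> \<le> C * norm x"
    "\<And>h y. h \<in> A \<Longrightarrow> h\<^sup>\<star> = h \<Longrightarrow> y \<in> A \<Longrightarrow> V h y = \<phi> (h * y)"
proof -
  let ?I = "{(h, y). h \<in> A \<and> h\<^sup>\<star> = h \<and> y \<in> A}"
  obtain \<phi> where \<phi>: "real_linear_on A \<phi>" "\<And>x. x \<in> A \<Longrightarrow> \<bar>\<phi> x\<bar> \<le> C * norm x"
    "\<And>i. i \<in> ?I \<Longrightarrow> \<phi> ((\<lambda>(h, y). h * y) i) = (\<lambda>(h, y). V h y) i"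
  proof (rule bounded_functional_compactness[OF _ subspace])
    fix F and e :: real assume F: "finite F" "F \<subseteq> ?I" and "e > 0"
    from self_adjoint_functional_approx[OF F(1) _ \<open>e > 0\<close>] F(2)
    show "\<exists>\<phi>. real_linear_on A \<phi> \<and> (\<forall>x\<in>A. \<bar>\<phi> x\<bar> \<le> C * norm x) \<and>
        (\<forall>i\<in>F. \<bar>\<phi> ((\<lambda>(h, y). h * y) i) - (\<lambda>(h, y). V h y) i\<bar> \<le> e)"
      by (simp add: case_prod_beta subset_iff)
  qed (auto simp: closed)
  show thesis
  proof (rule that[OF \<phi>(1,2)])
    show "V h y = \<phi> (h * y)" if "h \<in> A" "h\<^sup>\<star> = h" "y \<in> A" for h y
      using \<phi>(3)[of "(h, y)"] that by simp
  qed
qed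

lemma skew_functional:
  obtains \<phi> where "real_linear_on A \<phi>" "\<And>x. x \<in> A \<Longrightarrow> \<bar>\<phi> x\<bar> \<le> 27 * C * norm x"
    "\<And>k k'. k \<in> A \<Longrightarrow> k\<^sup>\<star> = - k \<Longrightarrow> k' \<in> A \<Longrightarrow> k'\<^sup>\<star> = - k' \<Longrightarrow> V k k' = \<phi> (k * k')"
proof -
  let ?S = "{k \<in> A. k\<^sup>\<star> = - k}"
  obtain \<phi> where \<phi>: "real_linear_on A \<phi>" "\<And>x. x \<in> A \<Longrightarrow> \<bar>\<phi> x\<bar> \<le> 27 * C * norm x"
    "\<And>i. i \<in> ?S \<times> ?S \<Longrightarrow> \<phi> (fst i * snd i) = V (fst i) (snd i)"
  proof (rule bounded_functional_compactness[OF _ subspace])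
    fix F and e :: real assume F: "finite F" "F \<subseteq> ?S \<times> ?S" and "e > 0"
    define K where "K = fst ` F \<union> snd ` F"
    have K: "finite K" "K \<subseteq> A" "\<And>k. k \<in> K \<Longrightarrow> k\<^sup>\<star> = - k" using F by (auto simp: K_def)
    obtain \<delta> where \<delta>: "\<delta> > 0" "\<And>y. y \<in> K \<Longrightarrow> C * sqrt \<delta> * norm y \<le> e"
      using small_damping[OF K(1) \<open>e > 0\<close>] by blast
    obtain \<phi> where \<phi>: "real_linear_on A \<phi>" "\<forall>x\<in>A. \<bar>\<phi> x\<bar> \<le> 27 * C * norm x"
      "\<And>k k'. k \<in> K \<Longrightarrow> k' \<in> K \<Longrightarrow> \<bar>\<phi> (k * k') - V k k'\<bar> \<le> C * sqrt \<delta> * norm k'"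
      using skew_functional_approx[OF K \<delta>(1)] by blast
    have "\<bar>\<phi> (fst i * snd i) - V (fst i) (snd i)\<bar> \<le> e" if "i \<in> F" for i
    proof -
      have i: "fst i \<in> K" "snd i \<in> K" using that by (simp_all add: K_def)
      show ?thesis using \<phi>(3)[OF i] \<delta>(2)[OF i(2)] by linarith
    qed
    with \<phi>(1,2) show "\<exists>\<phi>. real_linear_on A \<phi> \<and> (\<forall>x\<in>A. \<bar>\<phi> x\<bar> \<le> 27 * C * norm x) \<and>
        (\<forall>i\<in>F. \<bar>\<phi> (fst i * snd i) - V (fst i) (snd i)\<bar> \<le> e)" by blast
  qed (auto simp: closed)
  show thesis
  proof (rule that[OF \<phi>(1,2)])
    show "V k k' = \<phi> (k * k')" if "k \<in> A" "k\<^sup>\<star> = - k" "k' \<in> A" "k'\<^sup>\<star> = - k'" for k k'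
      using \<phi>(3)[of "(k, k')"] that by simp
  qed
qed

text \<open>Taking adjoints shows that orthogonality is symmetric. Through the swapped form, the
  result for a self-adjoint first argument also covers a self-adjoint second one.\<close>

lemma orthogonal_form_swap: "orthogonal_form A (\<lambda>x y. V y x) C"
proof
  have "cstar_orthogonal b a" if "cstar_orthogonal a b" for a b :: 'a
  proof -
    have "(a * b\<^sup>\<star>)\<^sup>\<star> = 0" "(b\<^sup>\<star> * a)\<^sup>\<star> = 0" using that by (simp_all add: cstar_orthogonal_def)
    then show ?thesis by (simp add: cstar_orthogonal_def star_mult star_star)
  qed
  then show "orthogonal_form_on A (\<lambda>x y. V y x)"
    using orth by (auto simp: orthogonal_form_on_def bilinear_form_on_def)
  show "\<bar>V y x\<bar> \<le> C * norm x * norm y" if "x \<in> A" "y \<in> A" for x y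
    using bound[OF that(2,1)] by (simp add: ac_simps)
qed (rule C)

end

section \<open>Continuity, and assembly of the two functionals\<close>

lemma dual_spaceI:
  assumes "subspace A" "real_linear_on A \<phi>" "0 \<le> K" "\<And>x. x \<in> A \<Longrightarrow> \<bar>\<phi> x\<bar> \<le> K * norm x"
  shows "\<phi> \<in> dual_space A"
proof -
  have "K-lipschitz_on A \<phi>"
  proof (rule lipschitz_onI)
    fix x y assume xy: "x \<in> A" "y \<in> A"
    have d: "x - y \<in> A" using assms(1) xy by (rule subspace_diff)
    then have "\<phi> (x - y + y) = \<phi> (x - y) + \<phi> y" using assms(2) xy unfolding real_linear_on_def by blast
    then show "dist (\<phi> x) (\<phi> y) \<le> K * dist x y"
      using assms(4)[OF d] by (simp add: dist_norm)
  qed (rule assms(3))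
  then show ?thesis using assms(2) by (simp add: dual_space_def lipschitz_on_continuous_on)
qed

text \<open>Continuity at the origin bounds the form on a small ball, and both arguments are
  rescaled into it; the radius d/3 for each keeps the pair within distance d.\<close>

lemma continuous_bilinear_form_bounded:
  fixes A :: "'a::real_normed_vector set"
  assumes "subspace A" and bil: "bilinear_form_on A V"
    and cont: "continuous_on (A \<times> A) (\<lambda>(x, y). V x y)"
  obtains C where "0 \<le> C" "\<And>x y. x \<in> A \<Longrightarrow> y \<in> A \<Longrightarrow> \<bar>V x y\<bar> \<le> C * norm x * norm y"
proof -
  have scale: "V (r *\<^sub>R x) (t *\<^sub>R y) = r * t * V x y" if "x \<in> A" "y \<in> A" for r t x y
    using bil that subspace_scale[OF assms(1)] by (simp add: bilinear_form_on_def real_linear_on_def)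
  have 0: "0 \<in> A" using assms(1) by (rule subspace_0)
  have V0: "V 0 y = 0" "V x 0 = 0" if "x \<in> A" "y \<in> A" for x y
    using scale[OF that, of 0 1] scale[OF that, of 1 0] by simp_all
  obtain d where "d > 0" and d: "\<And>p. p \<in> A \<times> A \<Longrightarrow> dist p (0, 0) < d \<Longrightarrow> dist (case_prod V p) (V 0 0) < 1"
    using cont 0 unfolding continuous_on_iff by (metis (no_types, lifting) SigmaI case_prod_conv zero_less_one)
  have small: "\<bar>V x y\<bar> < 1" if "x \<in> A" "y \<in> A" "norm x \<le> d / 3" "norm y \<le> d / 3" for x y
  proof -
    have "norm (x, y) \<le> norm x + norm y" by (rule norm_Pair_le)
    then have "dist (x, y) (0, 0) < d"
      using that \<open>d > 0\<close> by (simp add: dist_norm flip: zero_prod_def)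
    then show ?thesis using d[of "(x, y)"] that V0[OF 0 0] by (simp add: dist_norm)
  qed
  show thesis
  proof (rule that[of "(3 / d)\<^sup>2"])
    fix x y assume xy: "x \<in> A" "y \<in> A"
    show "\<bar>V x y\<bar> \<le> (3 / d)\<^sup>2 * norm x * norm y"
    proof (cases "x = 0 \<or> y = 0")
      case False
      define r t where "r = d / (3 * norm x)" and "t = d / (3 * norm y)"
      have rt: "r > 0" "t > 0" using False \<open>d > 0\<close> by (simp_all add: r_def t_def)
      have "\<bar>V (r *\<^sub>R x) (t *\<^sub>R y)\<bar> < 1"
        by (rule small)
          (use False xy \<open>d > 0\<close> subspace_scale[OF assms(1)] in \<open>simp_all add: r_def t_def\<close>)
      then have "r * t * \<bar>V x y\<bar> \<le> 1" using rt by (simp add: scale[OF xy] abs_mult)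
      then have "\<bar>V x y\<bar> \<le> 1 / (r * t)" using rt by (simp add: pos_le_divide_eq mult.commute)
      also have "\<dots> = (3 / d)\<^sup>2 * norm x * norm y"
        by (simp add: r_def t_def power2_eq_square)
      finally show ?thesis .
    qed (use V0 xy 0 in auto)
  qed simp
qed

theorem theorem1p1:
  fixes A :: "'a::complex_cstar_algebra set"
    and V :: "'a \<Rightarrow> 'a \<Rightarrow> real"
  assumes "commutative_real_cstar_algebra A"
    and "orthogonal_form_on A V"
    and "continuous_on (A \<times> A) (\<lambda>(x, y). V x y)"
  shows "\<exists>\<phi>\<^sub>1 \<in> dual_space A. \<exists>\<phi>\<^sub>2 \<in> dual_space A.
           \<forall>x\<in>A. \<forall>y\<in>A. V x y = \<phi>\<^sub>1 (x * y) + \<phi>\<^sub>2 (x * y\<^sup>\<star>)"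
proof -
  interpret comm_real_cstar A by unfold_locales (rule assms(1))
  have bil: "bilinear_form_on A V" using assms(2) by (simp add: orthogonal_form_on_def)
  obtain C where C: "0 \<le> C" "\<And>x y. x \<in> A \<Longrightarrow> y \<in> A \<Longrightarrow> \<bar>V x y\<bar> \<le> C * norm x * norm y"
    using continuous_bilinear_form_bounded[OF subspace bil assms(3)] by blast
  interpret orthogonal_form A V C by unfold_locales (use assms(2) C in auto)
  interpret swap: orthogonal_form A "\<lambda>x y. V y x" C by (rule orthogonal_form_swap)
  obtain \<Phi> where \<Phi>: "real_linear_on A \<Phi>" "\<And>x. x \<in> A \<Longrightarrow> \<bar>\<Phi> x\<bar> \<le> C * norm x"
    and V\<Phi>: "\<And>h y. h \<in> A \<Longrightarrow> h\<^sup>\<star> = h \<Longrightarrow> y \<in> A \<Longrightarrow> V h y = \<Phi> (h * y)"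
    using self_adjoint_functional by blast
  obtain \<Psi> where \<Psi>: "real_linear_on A \<Psi>" "\<And>x. x \<in> A \<Longrightarrow> \<bar>\<Psi> x\<bar> \<le> C * norm x"
    and V\<Psi>: "\<And>h y. h \<in> A \<Longrightarrow> h\<^sup>\<star> = h \<Longrightarrow> y \<in> A \<Longrightarrow> V y h = \<Psi> (h * y)"
    using swap.self_adjoint_functional by blast
  obtain \<Omega> where \<Omega>: "real_linear_on A \<Omega>" "\<And>x. x \<in> A \<Longrightarrow> \<bar>\<Omega> x\<bar> \<le> 27 * C * norm x"
    and V\<Omega>: "\<And>k k'. k \<in> A \<Longrightarrow> k\<^sup>\<star> = - k \<Longrightarrow> k' \<in> A \<Longrightarrow> k'\<^sup>\<star> = - k' \<Longrightarrow> V k k' = \<Omega> (k * k')"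
    using skew_functional by blast
  have lin: "\<phi> (x + y) = \<phi> x + \<phi> y" "\<phi> (r *\<^sub>R x) = r * \<phi> x" "\<phi> (x - y) = \<phi> x - \<phi> y"
    if "real_linear_on A \<phi>" "x \<in> A" "y \<in> A" for \<phi> r x y
  proof -
    show *: "\<phi> (x + y) = \<phi> x + \<phi> y" "\<phi> (r *\<^sub>R x) = r * \<phi> x" for r
      using that by (simp_all add: real_linear_on_def)
    have "x - y + y = x" "x - y \<in> A" using that by (simp_all add: closed)
    then show "\<phi> (x - y) = \<phi> x - \<phi> y" using that unfolding real_linear_on_def by (metis add_diff_cancel)
  qed
  define u where "u z = (1 / 2) *\<^sub>R (z + z\<^sup>\<star>)" for z :: 'a
  define v where "v z = (1 / 2) *\<^sub>R (z - z\<^sup>\<star>)" for z :: 'a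
  have uv: "u z \<in> A" "v z \<in> A" if "z \<in> A" for z using that by (simp_all add: u_def v_def closed)
  have uv_add: "u (x + y) = u x + u y" "v (x + y) = v x + v y" for x y
    by (simp_all add: u_def v_def star_add algebra_simps)
  have uv_scale: "u (r *\<^sub>R x) = r *\<^sub>R u x" "v (r *\<^sub>R x) = r *\<^sub>R v x" for r x
    by (simp_all add: u_def v_def star_scaleR algebra_simps)
  have norm_uv: "norm (u z) \<le> norm z" "norm (v z) \<le> norm z" for z
    using norm_triangle_ineq[of z "z\<^sup>\<star>"] norm_triangle_ineq4[of z "z\<^sup>\<star>"]
    by (simp_all add: u_def v_def)
  \<comment> \<open>The formula solves a linear system. For x = h + k and y = h' + k', the parts of
    \<open>x * y\<close> are h h' + k k' and h k' + k h', those of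
    \<open>x * y\<^sup>\<star>\<close> are h h' - k k' and k h' - h k'. So the sum and the
    difference of the two functionals must be \<Phi> and \<Omega> on self-adjoint elements, \<Psi>
    and \<Phi> on skew ones; \<open>s\<close> is the sign that tells the two apart.\<close>
  have dual: "(\<lambda>z. (\<Phi> (u z) + s * \<Omega> (u z)) / 2 + (\<Psi> (v z) + s * \<Phi> (v z)) / 2) \<in> dual_space A"
    if s: "\<bar>s\<bar> = 1" for s
  proof (rule dual_spaceI[OF subspace])
    show "real_linear_on A (\<lambda>z. (\<Phi> (u z) + s * \<Omega> (u z)) / 2 + (\<Psi> (v z) + s * \<Phi> (v z)) / 2)"
      unfolding real_linear_on_def
      by (auto simp: uv_add uv_scale lin[OF \<Phi>(1)] lin[OF \<Psi>(1)] lin[OF \<Omega>(1)] uv field_simps)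
    \<comment> \<open>The constant 15 is half of 1 + 27 + 1 + 1, the bounds of the four
      terms.\<close>
    show "\<bar>(\<Phi> (u z) + s * \<Omega> (u z)) / 2 + (\<Psi> (v z) + s * \<Phi> (v z)) / 2\<bar> \<le> (15 * C) * norm z"
      if z: "z \<in> A" for z
    proof -
      have average: "\<bar>(p + q) / 2 + (r + t) / 2\<bar> \<le> 15 * c"
        if "\<bar>p\<bar> \<le> c" "\<bar>q\<bar> \<le> 27 * c" "\<bar>r\<bar> \<le> c" "\<bar>t\<bar> \<le> c" for p q r t c :: real
        using that by (intro abs_leI) (simp_all add: abs_le_iff field_simps)
      define c where "c = C * norm z"
      have le: "C * norm (u z) \<le> c" "C * norm (v z) \<le> c"
        unfolding c_def using norm_uv C(1) by (intro mult_left_mono; simp)+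
      have "\<bar>\<Phi> (u z)\<bar> \<le> c" "\<bar>\<Phi> (v z)\<bar> \<le> c" "\<bar>\<Psi> (v z)\<bar> \<le> c" "\<bar>\<Omega> (u z)\<bar> \<le> 27 * c"
        using \<Phi>(2)[OF uv(1)[OF z]] \<Phi>(2)[OF uv(2)[OF z]] \<Psi>(2)[OF uv(2)[OF z]] \<Omega>(2)[OF uv(1)[OF z]] le
        by linarith+
      moreover have "\<bar>s * \<Omega> (u z)\<bar> = \<bar>\<Omega> (u z)\<bar>" "\<bar>s * \<Phi> (v z)\<bar> = \<bar>\<Phi> (v z)\<bar>"
        using s by (simp_all add: abs_mult)
      ultimately have "\<bar>(\<Phi> (u z) + s * \<Omega> (u z)) / 2 + (\<Psi> (v z) + s * \<Phi> (v z)) / 2\<bar> \<le> 15 * c"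
        by (intro average) simp_all
      then show ?thesis by (simp add: c_def)
    qed
  qed (use C in simp)
  define \<phi>\<^sub>1 where "\<phi>\<^sub>1 z = (\<Phi> (u z) + 1 * \<Omega> (u z)) / 2 + (\<Psi> (v z) + 1 * \<Phi> (v z)) / 2" for z
  define \<phi>\<^sub>2 where "\<phi>\<^sub>2 z = (\<Phi> (u z) + - 1 * \<Omega> (u z)) / 2 + (\<Psi> (v z) + - 1 * \<Phi> (v z)) / 2" for z
  have "V x y = \<phi>\<^sub>1 (x * y) + \<phi>\<^sub>2 (x * y\<^sup>\<star>)" if xy: "x \<in> A" "y \<in> A" for x y
  proof -
    define h k h' k' where "h = u x" and "k = v x" and "h' = u y" and "k' = v y"
    have mem: "h \<in> A" "k \<in> A" "h' \<in> A" "k' \<in> A" using uv xy by (simp_all add: h_def k_def h'_def k'_def)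
    have st: "h\<^sup>\<star> = h" "k\<^sup>\<star> = - k" "h'\<^sup>\<star> = h'" "k'\<^sup>\<star> = - k'"
      by (simp_all add: h_def k_def h'_def k'_def u_def v_def star_add star_diff star_scaleR star_star
          add.commute flip: scaleR_minus_right)
    have half: "u z + v z = z" for z
    proof -
      have "u z + v z = (1 / 2) *\<^sub>R (z + z)" by (simp add: u_def v_def flip: scaleR_add_right)
      then show ?thesis by (simp flip: scaleR_2)
    qed
    have x: "x = h + k" and y: "y = h' + k'" by (simp_all add: half h_def k_def h'_def k'_def)
    have split: "u z = p" "v z = q" if "z = p + q" "p\<^sup>\<star> = p" "q\<^sup>\<star> = - q" for z p q
      using that by (simp_all add: u_def v_def star_add flip: scaleR_2)
    note com = commute[OF mem(3,1)] commute[OF mem(4,2)] commute[OF mem(3,2)] commute[OF mem(4,1)]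
    have "x * y = (h * h' + k * k') + (h * k' + k * h')"
      by (simp add: x y algebra_simps)
    from split[OF this] have xy1: "u (x * y) = h * h' + k * k'" "v (x * y) = h * k' + k * h'"
      by (simp_all add: star_add star_mult st com)
    have "x * y\<^sup>\<star> = (h * h' - k * k') + (k * h' - h * k')"
      by (simp add: x y star_add st algebra_simps)
    from split[OF this] have xy2: "u (x * y\<^sup>\<star>) = h * h' - k * k'" "v (x * y\<^sup>\<star>) = k * h' - h * k'"
      by (simp_all add: star_diff star_mult st com)
    have prod: "h * h' \<in> A" "k * k' \<in> A" "h * k' \<in> A" "k * h' \<in> A" using mem by (simp_all add: closed)
    have "V x y = V h h' + V h k' + V k h' + V k k'"
      using mem by (simp add: x y V_add_left V_add_right closed)
    also have "\<dots> = \<Phi> (h * h') + \<Phi> (h * k') + \<Psi> (k * h') + \<Omega> (k * k')"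
      using V\<Phi>[OF mem(1) st(1) mem(3)] V\<Phi>[OF mem(1) st(1) mem(4)] V\<Psi>[OF mem(3) st(3) mem(2)]
        V\<Omega>[OF mem(2) st(2) mem(4) st(4)] com(3) by simp
    also have "\<dots> = \<phi>\<^sub>1 (x * y) + \<phi>\<^sub>2 (x * y\<^sup>\<star>)"
      unfolding \<phi>\<^sub>1_def \<phi>\<^sub>2_def xy1 xy2
      using prod by (simp add: lin[OF \<Phi>(1)] lin[OF \<Psi>(1)] lin[OF \<Omega>(1)] field_simps)
    finally show ?thesis .
  qed
  moreover have "\<phi>\<^sub>1 \<in> dual_space A" unfolding \<phi>\<^sub>1_def by (rule dual) simp
  moreover have "\<phi>\<^sub>2 \<in> dual_space A" unfolding \<phi>\<^sub>2_def by (rule dual) simp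
  ultimately show ?thesis by blast
qed

end
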